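(* Let $b\in\omega^\omega$ with $b(k)\geq 1$ for all $k$ and $b(k)\geq 2$ for all but finitely many $k$. Then the following hold (provably in ZFC). (i) $\mathrm{add}(\mathcal M)\leq\mathfrak b_b^{\mathsf{eq}}\leq\mathrm{non}(\mathcal M)$ and $\mathrm{cov}(\mathcal M)\leq\mathfrak d_b^{\mathsf{eq}}\leq\mathrm{cof}(\mathcal M)$. (ii) Additionally, if $\sum_{k<\omega}\frac{1}{b(k)}=\infty$, then $\mathrm{cov}(\mathcal N)\leq\mathfrak b_b^{\mathsf{eq}}$ and $\mathfrak d_b^{\mathsf{eq}}\leq\mathrm{non}(\mathcal N)$. (iii) The remaining inequalities of the diagram: $\aleph_1\leq\mathrm{add}(\mathcal N)\leq\mathrm{cov}(\mathcal N)\leq\mathrm{non}(\mathcal M)\leq\mathrm{cof}(\mathcal M)\leq\mathrm{cof}(\mathcal N)\leq\mathfrak c$; $\mathrm{add}(\mathcal N)\leq\mathrm{add}(\mathcal M)\leq\mathrm{cov}(\mathcal M)\leq\mathrm{non}(\mathcal N)\leq\mathrm{cof}(\mathcal N)$; $\mathrm{add}(\mathcal M)\leq\mathfrak b\leq\mathrm{non}(\mathcal M)$; $\mathrm{cov}(\mathcal M)\leq\mathfrak d\leq\mathrm{cof}(\mathcal M)$; $\mathfrak b\leq\mathfrak d$; $\mathrm{add}(\mathcal M)\leq\mathrm{non}(\mathcal E)$, $\mathrm{non}(\mathcal E)\leq\mathrm{non}(\mathcal M)$, $\mathrm{non}(\mathcal E)\leq\mathrm{non}(\mathcal N)$, $\mathrm{non}(\mathcal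 E)\leq\mathrm{cof}(\mathcal M)$; $\mathrm{add}(\mathcal M)\leq\mathrm{cov}(\mathcal E)$, $\mathrm{cov}(\mathcal M)\leq\mathrm{cov}(\mathcal E)$, $\mathrm{cov}(\mathcal N)\leq\mathrm{cov}(\mathcal E)$, $\mathrm{cov}(\mathcal E)\leq\mathrm{cof}(\mathcal M)$.
   Context: $\forall^\infty n$ means "for all but finitely many $n<\omega$". $\mathbb I$ is the set of partitions $I=\langle I_n : n<\omega\rangle$ of $\omega$ into finite non-empty intervals (enumerated increasingly). For $b\in\omega^\omega$, $\prod b=\prod_{n<\omega} b(n)$, where $b(n)=\{0,\dots,b(n)-1\}$. For $I\in\mathbb I$ and $f,h\in\prod b$, write $f\sqsubset^{\bullet}(I,h)$ iff $\forall^\infty n\ \exists k\in I_n:\ f(k)=h(k)$. Define $$\mathfrak b_b^{\mathsf{eq}}=\min\{|F| : F\subseteq\prod b,\ \neg\exists I\in\mathbb I\ \exists h\in\prod b\ \forall f\in F:\ f\sqsubset^{\bullet}(I,h)\},$$ $$\mathfrak d_b^{\mathsf{eq}}=\min\{|D| : D\subseteq\mathbb I\times\prod b,\ \forall f\in\prod b\ \exists (I,h)\in D:\ f\sqsubset^{\bullet}(I,h)\}.$$ For an ideal $\mathcal I$ of subsets of $X$ containing all singletons: $\mathrm{add}(\mathcal I)=\min\{|\mathcal J| : \mathcal J\subseteq\mathcal I,\ \bigcup\mathcal J\notin\mathcal I\}$; $\mathrm{cov}(\mathcal I)=\min\{|\mathcal J| : \mathcal J\subseteq\mathcal I,\ \bigcup\mathcal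 J=X\}$; $\mathrm{non}(\mathcal I)=\min\{|A| : A\subseteq X,\ A\notin\mathcal I\}$; $\mathrm{cof}(\mathcal I)=\min\{|\mathcal J| : \mathcal J\subseteq\mathcal I,\ \forall A\in\mathcal I\ \exists B\in\mathcal J:\ A\subseteq B\}$. $\mathcal M$, $\mathcal N$ and $\mathcal E$ denote, respectively, the ideals of meager sets, of Lebesgue measure zero sets, and the ideal generated by the $F_\sigma$ (equivalently, $\sigma$-ideal generated by the closed) measure zero sets, on $2^\omega$ with the product of the uniform measures on $\{0,1\}$ (the cardinals do not change if one uses $\mathbb R$ or another perfect product $\prod b$ instead). $\mathfrak b$ and $\mathfrak d$ are the bounding and dominating numbers of $\langle\omega^\omega,\leq^*\rangle$, where $f\leq^* g$ iff $\forall^\infty n:\ f(n)\leq g(n)$, and $\mathfrak c=2^{\aleph_0}$. *)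

theory Defs
  imports "HOL-Probability.Probability"
begin

unbundle cardinal_syntax

text \<open>
  Cardinals are well-orders as in \<^theory>\<open>HOL.BNF_Cardinal_Order_Relation\<close>; they are compared by
  \<open>\<le>o\<close>, which also relates cardinals over different types. For a nonempty class \<open>S\<close> of sets the
  following is \<open>min {|A| : A \<in> S}\<close>; the value for empty \<open>S\<close> is irrelevant here, since
  every class used below is nonempty in the situations considered.
\<close>

definition min_card :: "'a set set \<Rightarrow> 'a rel"
  where "min_card S = |SOME A. A \<in> S \<and> (\<forall>B\<in>S. |A| \<le>o |B| )|"

lemma min_card_attained:
  assumes "S \<noteq> {}"
  obtains A where "A \<in> S" "min_card S = |A|" "\<And>B. B \<in> S \<Longrightarrow> |A| \<le>o |B|"
proof -
  have "\<exists>r \<in> card_of ` S. \<forall>r' \<in> card_of ` S. r \<le>o r'"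
    using assms by (intro exists_minim_Card_order) (auto simp: card_of_Card_order)
  then have "\<exists>A. A \<in> S \<and> (\<forall>B\<in>S. |A| \<le>o |B| )"
    by blast
  from someI_ex[OF this] show ?thesis
    by (intro that) (auto simp: min_card_def)
qed

definition aleph_one :: "nat set rel"
  where "aleph_one = cardSuc natLeq"

abbreviation continuum :: "(nat \<Rightarrow> bool) rel"
  where "continuum \<equiv> ctwo ^c natLeq"

definition add_ideal :: "'a set set \<Rightarrow> 'a set rel"
  where "add_ideal \<I> = min_card {\<J>. \<J> \<subseteq> \<I> \<and> \<Union>\<J> \<notin> \<I>}"

definition cov_ideal :: "'a set set \<Rightarrow> 'a set rel"
  where "cov_ideal \<I> = min_card {\<J>. \<J> \<subseteq> \<I> \<and> \<Union>\<J> = UNIV}"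

definition non_ideal :: "'a set set \<Rightarrow> 'a rel"
  where "non_ideal \<I> = min_card {A. A \<notin> \<I>}"

definition cof_ideal :: "'a set set \<Rightarrow> 'a set rel"
  where "cof_ideal \<I> = min_card {\<J>. \<J> \<subseteq> \<I> \<and> (\<forall>A\<in>\<I>. \<exists>B\<in>\<J>. A \<subseteq> B)}"

text \<open>
  The Cantor space is the type \<^typ>\<open>nat \<Rightarrow> bool\<close>, whose topology is the product of the
  discrete topologies on \<^typ>\<open>bool\<close>.
\<close>

definition nowhere_dense :: "'a::topological_space set \<Rightarrow> bool"
  where "nowhere_dense A \<longleftrightarrow> interior (closure A) = {}"

definition meager :: "'a::topological_space set \<Rightarrow> bool"
  where "meager A \<longleftrightarrow> (\<exists>F :: nat \<Rightarrow> 'a set. (\<forall>n. nowhere_dense (F n)) \<and> A = (\<Union>n. F n))"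

definition cantor_measure :: "(nat \<Rightarrow> bool) measure"
  where "cantor_measure = Pi\<^sub>M UNIV (\<lambda>_. uniform_count_measure (UNIV :: bool set))"

definition generated_ideal :: "'a set set \<Rightarrow> 'a set set"
  where "generated_ideal S = {A. \<exists>\<F>. finite \<F> \<and> \<F> \<subseteq> S \<and> A \<subseteq> \<Union>\<F>}"

definition meager_ideal :: "(nat \<Rightarrow> bool) set set"
  where "meager_ideal = {A. meager A}"

definition null_ideal :: "(nat \<Rightarrow> bool) set set"
  where "null_ideal = null_sets (completion cantor_measure)"

definition E_ideal :: "(nat \<Rightarrow> bool) set set"
  where "E_ideal = generated_ideal {F \<in> null_ideal. fsigma F}"

definition le_star :: "(nat \<Rightarrow> nat) \<Rightarrow> (nat \<Rightarrow> nat) \<Rightarrow> bool"  (infix \<open>\<le>\<^sup>*\<close> 50)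
  where "f \<le>\<^sup>* g \<longleftrightarrow> (\<forall>\<^sub>\<infinity>n. f n \<le> g n)"

definition bounding_number :: "(nat \<Rightarrow> nat) rel"
  where "bounding_number = min_card {F. \<not> (\<exists>g. \<forall>f\<in>F. f \<le>\<^sup>* g)}"

definition dominating_number :: "(nat \<Rightarrow> nat) rel"
  where "dominating_number = min_card {D. \<forall>f. \<exists>g\<in>D. f \<le>\<^sup>* g}"

definition bounded_functions :: "(nat \<Rightarrow> nat) \<Rightarrow> (nat \<Rightarrow> nat) set"
  where "bounded_functions b = (\<Pi> n\<in>UNIV. {..<b n})"

definition interval_partitions :: "(nat \<Rightarrow> nat set) set"
  where "interval_partitions =
    {I. (\<forall>n. \<exists>i j. i \<le> j \<and> I n = {i..j}) \<and>
        (\<forall>m n. m < n \<longrightarrow> (\<forall>x\<in>I m. \<forall>y\<in>I n. x < y)) \<and>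
        (\<Union>n. I n) = UNIV}"

definition eq_bounded :: "(nat \<Rightarrow> nat) \<Rightarrow> (nat \<Rightarrow> nat set) \<times> (nat \<Rightarrow> nat) \<Rightarrow> bool"
    (infix \<open>\<sqsubset>\<^sup>\<bullet>\<close> 50)
  where "f \<sqsubset>\<^sup>\<bullet> Ih \<longleftrightarrow> (\<forall>\<^sub>\<infinity>n. \<exists>k \<in> fst Ih n. f k = snd Ih k)"

definition b_eq :: "(nat \<Rightarrow> nat) \<Rightarrow> (nat \<Rightarrow> nat) rel"
  where "b_eq b = min_card
    {F. F \<subseteq> bounded_functions b \<and>
        \<not> (\<exists>I\<in>interval_partitions. \<exists>h\<in>bounded_functions b. \<forall>f\<in>F. f \<sqsubset>\<^sup>\<bullet> (I, h))}"

definition d_eq :: "(nat \<Rightarrow> nat) \<Rightarrow> ((nat \<Rightarrow> nat set) \<times> (nat \<Rightarrow> nat)) rel"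
  where "d_eq b = min_card
    {D. D \<subseteq> interval_partitions \<times> bounded_functions b \<and>
        (\<forall>f\<in>bounded_functions b. \<exists>(I, h)\<in>D. f \<sqsubset>\<^sup>\<bullet> (I, h))}"

end

theory Submission
  imports Defs
begin

text \<open>
  Every cardinal in the diagram is the norm of a relational system: for a relation \<open>R\<close> between
  challenges \<open>X\<close> and responses \<open>Y\<close> it is either the least size of a set of challenges that no single
  response meets, or the least size of a set of responses that meets every challenge. A Tukey
  connection, that is a pair of maps \<open>\<phi>: X \<rightarrow> X'\<close>, \<open>\<psi>: Y' \<rightarrow> Y\<close> such that \<open>R' (\<phi> x) y\<close> implies
  \<open>R x (\<psi> y)\<close>, compares both norms at once. All inequalities except the two outermost ones
  (\<open>aleph_one\<close> below, the continuum above) come from such connections.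

  The connections that start or end in the meager ideal rest on one description of meager sets
  (\<open>meager_imp_blocks\<close> and \<open>meager_avoiding\<close>): up to inclusion a meager set consists of the points
  which, for some interval partition and some \<open>z\<close>, agree with \<open>z\<close> on only finitely many of the
  intervals. So, to show that a meager set \<open>\<phi> x\<close> is not contained in a meager set \<open>B\<close>, one copies the
  point \<open>z\<close> of \<open>B\<close> on infinitely many intervals and behaves generically for \<open>\<phi> x\<close> elsewhere. In this
  way the response \<open>\<psi> B\<close> can be read off from the partition and \<open>z\<close>: the right end points of the
  intervals dominate (\<open>tukey_le_star_meager\<close>), the pair of the partition and the function coded by \<open>z\<close>
  meets \<open>f\<close> (\<open>tukey_eq_meager\<close>), and the points that repeat a window of \<open>z\<close> inside almost every
  interval form an \<open>F\<^sub>\<sigma>\<close> null set (\<open>tukey_point_E_meager\<close>).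

  The connection from the meager to the null ideal (\<open>tukey_meager_null\<close>, the theorem of
  Bartoszynski and of Raisonnier and Stern) passes through slaloms, that is sequences of finite sets
  \<open>S n\<close> with an explicit bound on their sizes. A null set \<open>B\<close> determines a slalom that captures every
  \<open>f\<close> whose null set \<open>row_null_set f\<close> lies in \<open>B\<close> (\<open>null_captures_slalom\<close>); a slalom determines a meager set
  that contains every meager set whose code it captures (\<open>slalom_captures_meager\<close>).

  The covering number of each of these two ideals is at most the uniformity of the other one. The
  reason is the relation that \<open>x\<close> and \<open>y\<close> agree on infinitely many of the windows \<open>[n, 2n)\<close>, which
  for fixed \<open>y\<close> holds on a comeager null set (\<open>tukey_meager_null_dual\<close>). If \<open>\<Sum> 1/b(k)\<close> diverges, then by independence almost
  every \<open>h\<close> agrees with a fixed \<open>f\<close> in almost every member of a partition into intervals of large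
  weight (\<open>tukey_eq_null_dual\<close>).
\<close>

section \<open>Relational systems and Tukey connections\<close>

definition bounding_card :: "'a set \<Rightarrow> 'b set \<Rightarrow> ('a \<Rightarrow> 'b \<Rightarrow> bool) \<Rightarrow> 'a rel"
  where "bounding_card X Y R = min_card {F. F \<subseteq> X \<and> \<not> (\<exists>y\<in>Y. \<forall>x\<in>F. R x y)}"

definition dominating_card :: "'a set \<Rightarrow> 'b set \<Rightarrow> ('a \<Rightarrow> 'b \<Rightarrow> bool) \<Rightarrow> 'b rel"
  where "dominating_card X Y R = min_card {D. D \<subseteq> Y \<and> (\<forall>x\<in>X. \<exists>y\<in>D. R x y)}"

text \<open>
  The direction is chosen so that \<open>tukey X Y R X' Y' R'\<close> says that \<open>R\<close> is below \<open>R'\<close>: responses for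
  \<open>R'\<close> can be turned into responses for \<open>R\<close>.
\<close>

definition tukey ::
  "'a set \<Rightarrow> 'b set \<Rightarrow> ('a \<Rightarrow> 'b \<Rightarrow> bool) \<Rightarrow> 'c set \<Rightarrow> 'd set \<Rightarrow> ('c \<Rightarrow> 'd \<Rightarrow> bool) \<Rightarrow> bool"
  where "tukey X Y R X' Y' R' \<longleftrightarrow>
    (\<exists>\<phi> \<psi>. (\<forall>x\<in>X. \<phi> x \<in> X') \<and> (\<forall>y\<in>Y'. \<psi> y \<in> Y) \<and>
           (\<forall>x\<in>X. \<forall>y\<in>Y'. R' (\<phi> x) y \<longrightarrow> R x (\<psi> y)))"

lemma tukeyI:
  assumes "\<And>x. x \<in> X \<Longrightarrow> \<phi> x \<in> X'" "\<And>y. y \<in> Y' \<Longrightarrow> \<psi> y \<in> Y"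
    "\<And>x y. x \<in> X \<Longrightarrow> y \<in> Y' \<Longrightarrow> R' (\<phi> x) y \<Longrightarrow> R x (\<psi> y)"
  shows "tukey X Y R X' Y' R'"
  unfolding tukey_def by (rule exI[of _ \<phi>], rule exI[of _ \<psi>]) (use assms in blast)

lemma tukeyI_ex:
  assumes "\<And>x. x \<in> X \<Longrightarrow> \<phi> x \<in> X'"
    "\<And>y. y \<in> Y' \<Longrightarrow> \<exists>v\<in>Y. \<forall>x\<in>X. R' (\<phi> x) y \<longrightarrow> R x v"
  shows "tukey X Y R X' Y' R'"
proof -
  from assms(2) have "\<exists>\<psi>. \<forall>y\<in>Y'. \<psi> y \<in> Y \<and> (\<forall>x\<in>X. R' (\<phi> x) y \<longrightarrow> R x (\<psi> y))"
    by metis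
  then obtain \<psi> where "\<forall>y\<in>Y'. \<psi> y \<in> Y \<and> (\<forall>x\<in>X. R' (\<phi> x) y \<longrightarrow> R x (\<psi> y))" ..
  then show ?thesis
    by (intro tukeyI[of _ \<phi> _ _ \<psi>]) (auto simp: assms(1))
qed

lemma min_card_le: "B \<in> S \<Longrightarrow> min_card S \<le>o |B|"
  by (metis empty_iff min_card_attained)

lemma min_card_le_image:
  assumes "S \<noteq> {}" "\<And>A. A \<in> S \<Longrightarrow> f ` A \<in> S'"
  shows "min_card S' \<le>o min_card S"
proof -
  obtain A where A: "A \<in> S" "min_card S = |A|"
    using min_card_attained[OF assms(1)] by metis
  have "min_card S' \<le>o |f ` A|"
    using assms(2) A(1) by (intro min_card_le)
  also have "|f ` A| \<le>o |A|"
    by (rule card_of_image)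
  finally show ?thesis
    using A(2) by simp
qed

text \<open>
  The image under \<open>\<phi>\<close> of an unbounded set is unbounded, because a bound \<open>y\<close> of the image would give
  the bound \<open>\<psi> y\<close> of the set. The second assumption makes the class of unbounded sets nonempty, so
  that its minimum is attained.
\<close>

lemma tukey_bounding_card:
  assumes "tukey X Y R X' Y' R'" "\<And>y. y \<in> Y \<Longrightarrow> \<exists>x\<in>X. \<not> R x y"
  shows "bounding_card X' Y' R' \<le>o bounding_card X Y R"
proof -
  from assms(1) obtain \<phi> \<psi> where *: "\<forall>x\<in>X. \<phi> x \<in> X'" "\<forall>y\<in>Y'. \<psi> y \<in> Y"
    "\<forall>x\<in>X. \<forall>y\<in>Y'. R' (\<phi> x) y \<longrightarrow> R x (\<psi> y)"
    unfolding tukey_def by blast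
  show ?thesis
    unfolding bounding_card_def
  proof (rule min_card_le_image[where f = \<phi>])
    show "{F. F \<subseteq> X \<and> \<not> (\<exists>y\<in>Y. \<forall>x\<in>F. R x y)} \<noteq> {}"
      using assms(2) by blast
  next
    fix F assume F: "F \<in> {F. F \<subseteq> X \<and> \<not> (\<exists>y\<in>Y. \<forall>x\<in>F. R x y)}"
    have "\<not> (\<exists>y\<in>Y'. \<forall>x\<in>\<phi> ` F. R' x y)"
    proof
      assume "\<exists>y\<in>Y'. \<forall>x\<in>\<phi> ` F. R' x y"
      then obtain y where y: "y \<in> Y'" "\<forall>x\<in>F. R' (\<phi> x) y" by blast
      then have "\<psi> y \<in> Y" "\<forall>x\<in>F. R x (\<psi> y)"
        using F * by blast+
      then show False using F by blast
    qed
    then show "\<phi> ` F \<in> {F. F \<subseteq> X' \<and> \<not> (\<exists>y\<in>Y'. \<forall>x\<in>F. R' x y)}"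
      using F *(1) by blast
  qed
qed

text \<open>
  Exchanging challenges and responses and negating the relation turns dominating sets into unbounded
  ones, so that the comparison of dominating numbers follows from that of bounding numbers.
\<close>

lemma tukey_dual:
  "tukey X Y R X' Y' R' \<Longrightarrow> tukey Y' X' (\<lambda>y x. \<not> R' x y) Y X (\<lambda>y x. \<not> R x y)"
  unfolding tukey_def by blast

lemma dominating_card_eq_dual: "dominating_card X Y R = bounding_card Y X (\<lambda>y x. \<not> R x y)"
  unfolding dominating_card_def bounding_card_def by (rule arg_cong[where f = min_card]) blast

lemma tukey_dominating_card:
  assumes "tukey X Y R X' Y' R'" "\<And>x. x \<in> X' \<Longrightarrow> \<exists>y\<in>Y'. R' x y"
  shows "dominating_card X Y R \<le>o dominating_card X' Y' R'"
  unfolding dominating_card_eq_dual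
  by (rule tukey_bounding_card[OF tukey_dual[OF assms(1)]]) (use assms(2) in blast)

section \<open>Topology of the Cantor space\<close>

definition agreeing :: "(nat \<Rightarrow> bool) \<Rightarrow> nat set \<Rightarrow> (nat \<Rightarrow> bool) set"
  where "agreeing z D = {x. \<forall>i\<in>D. x i = z i}"

lemma agreeingI: "(\<And>i. i \<in> D \<Longrightarrow> x i = z i) \<Longrightarrow> x \<in> agreeing z D"
  by (simp add: agreeing_def)

lemma agreeingD: "x \<in> agreeing z D \<Longrightarrow> i \<in> D \<Longrightarrow> x i = z i"
  by (simp add: agreeing_def)

lemma agreeing_self [simp]: "z \<in> agreeing z D"
  by (simp add: agreeing_def)

lemma agreeing_sym: "x \<in> agreeing z D \<longleftrightarrow> z \<in> agreeing x D"
  by (auto simp: agreeing_def)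

lemma agreeing_mono: "D \<subseteq> D' \<Longrightarrow> agreeing z D' \<subseteq> agreeing z D"
  by (auto simp: agreeing_def)

lemma agreeing_trans:
  "x \<in> agreeing y D' \<Longrightarrow> y \<in> agreeing z D \<Longrightarrow> D \<subseteq> D' \<Longrightarrow> x \<in> agreeing z D"
  unfolding agreeing_def by (simp add: subset_iff)

text \<open>
  For finite \<open>D\<close> this makes \<open>E\<close> clopen, and events that are determined by disjoint sets of coordinates are
  independent.
\<close>

definition determined_by :: "nat set \<Rightarrow> (nat \<Rightarrow> bool) set \<Rightarrow> bool"
  where "determined_by D E \<longleftrightarrow> (\<forall>x\<in>E. agreeing x D \<subseteq> E)"

lemma determined_by_agreeing: "determined_by D (agreeing z D)"
  by (auto simp: determined_by_def agreeing_def)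

lemma determined_by_Compl: "determined_by D E \<Longrightarrow> determined_by D (- E)"
  unfolding determined_by_def by (metis ComplD ComplI agreeing_sym subsetD subsetI)

lemma determined_by_UN:
  "(\<And>i. i \<in> T \<Longrightarrow> determined_by D (E i)) \<Longrightarrow> determined_by D (\<Union>i\<in>T. E i)"
  unfolding determined_by_def by blast

lemma determined_by_mono: "determined_by D E \<Longrightarrow> D \<subseteq> D' \<Longrightarrow> determined_by D' E"
  unfolding determined_by_def using agreeing_mono by blast

lemma open_agreeing: assumes "finite D" shows "open (agreeing z D)"
proof -
  have "open {f. \<forall>i\<in>D. f i \<in> {z i}}"
    by (rule product_topology_basis'[where x = "\<lambda>i. i" and U = "\<lambda>i. {z i}"]) (rule assms discrete_topology_class.open_discrete)+
  then show ?thesis by (simp add: agreeing_def)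
qed

lemma open_cantor_iff: "open U \<longleftrightarrow> (\<forall>x\<in>U. \<exists>n. agreeing x {..<n} \<subseteq> U)"
proof (intro iffI ballI)
  fix x assume "open U" "x \<in> U"
  then have "openin (product_topology (\<lambda>i. euclidean) UNIV) U"
    by (simp add: open_fun_def)
  from product_topology_open_contains_basis[OF this \<open>x \<in> U\<close>]
  obtain X where X: "x \<in> (\<Pi>\<^sub>E i\<in>UNIV. X i)" "finite {i::nat. X i \<noteq> (UNIV :: bool set)}"
    "(\<Pi>\<^sub>E i\<in>UNIV. X i) \<subseteq> U"
    by auto
  obtain n where n: "{i. X i \<noteq> UNIV} \<subseteq> {..<n}"
    using X(2) finite_nat_iff_bounded by blast
  have "y \<in> (\<Pi>\<^sub>E i\<in>UNIV. X i)" if "y \<in> agreeing x {..<n}" for y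
  proof -
    have "y i \<in> X i" for i
    proof (cases "X i = UNIV")
      case False
      then have "y i = x i" using n that by (auto simp: agreeing_def)
      then show ?thesis using X(1) by (auto simp: PiE_iff)
    qed auto
    then show ?thesis by (auto simp: PiE_iff)
  qed
  then show "\<exists>n. agreeing x {..<n} \<subseteq> U" using X(3) by blast
next
  assume *: "\<forall>x\<in>U. \<exists>n. agreeing x {..<n} \<subseteq> U"
  then obtain n where n: "\<forall>x\<in>U. agreeing x {..<n x} \<subseteq> U" by metis
  have "open (\<Union>x\<in>U. agreeing x {..<n x})"
    by (intro open_UN ballI open_agreeing finite_lessThan)
  moreover have "(\<Union>x\<in>U. agreeing x {..<n x}) = U"
    using n agreeing_self by blast
  ultimately show "open U" by simp
qed

lemma open_determined_by: assumes "finite D" "determined_by D E" shows "open E"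
proof -
  have "open (\<Union>x\<in>E. agreeing x D)"
    using assms(1) by (intro open_UN ballI open_agreeing)
  moreover have "(\<Union>x\<in>E. agreeing x D) = E"
    using assms(2) agreeing_self unfolding determined_by_def by blast
  ultimately show ?thesis by simp
qed

lemma closed_determined_by: "finite D \<Longrightarrow> determined_by D E \<Longrightarrow> closed E"
  using open_determined_by determined_by_Compl by (auto simp: closed_def)

definition pattern_set :: "nat \<times> bool list \<Rightarrow> (nat \<Rightarrow> bool) set"
  where "pattern_set p = {x. \<forall>i<length (snd p). x (fst p + i) = snd p ! i}"

lemma pattern_set_eq: "pattern_set (a, l) = agreeing (\<lambda>j. l ! (j - a)) {a..<a + length l}"
proof (intro set_eqI iffI)
  fix x assume "x \<in> pattern_set (a, l)"
  then have *: "x (a + i) = l ! i" if "i < length l" for i using that by (simp add: pattern_set_def)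
  show "x \<in> agreeing (\<lambda>j. l ! (j - a)) {a..<a + length l}"
  proof (rule agreeingI)
    fix j assume "j \<in> {a..<a + length l}"
    then show "x j = l ! (j - a)" using *[of "j - a"] by auto
  qed
next
  fix x assume x: "x \<in> agreeing (\<lambda>j. l ! (j - a)) {a..<a + length l}"
  have "x (a + i) = l ! i" if "i < length l" for i
    using agreeingD[OF x, of "a + i"] that by simp
  then show "x \<in> pattern_set (a, l)" by (simp add: pattern_set_def)
qed

lemma pattern_set_prefix: "pattern_set (0, map x [0..<n]) = agreeing x {..<n}"
  unfolding pattern_set_def agreeing_def by simp blast

text \<open>
  There are only countably many patterns. This gives measurability of open sets, and it lets a single
  point of the Cantor space code a sequence of open sets.
\<close>

lemma open_eq_UN_patterns:
  assumes "open U"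
  shows "U = (\<Union>s\<in>{s. pattern_set (0, s) \<subseteq> U}. pattern_set (0, s))"
proof (intro equalityI subsetI)
  fix x assume "x \<in> U"
  then obtain n where "agreeing x {..<n} \<subseteq> U" using assms unfolding open_cantor_iff by blast
  then show "x \<in> (\<Union>s\<in>{s. pattern_set (0, s) \<subseteq> U}. pattern_set (0, s))"
    by (intro UN_I[of "map x [0..<n]"]) (simp_all add: pattern_set_prefix)
qed blast

lemma nowhere_dense_iff:
  "nowhere_dense A \<longleftrightarrow> (\<forall>z n. \<exists>y\<in>agreeing z {..<n}. \<exists>m. agreeing y {..<m} \<inter> A = {})"
proof (intro iffI allI)
  fix z n assume "nowhere_dense A"
  then have "\<not> agreeing z {..<n} \<subseteq> closure A"
    using interior_maximal[OF _ open_agreeing, of z "{..<n}" "closure A"] agreeing_self[of z "{..<n}"]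
    unfolding nowhere_dense_def by blast
  then obtain y where y: "y \<in> agreeing z {..<n}" "y \<in> - closure A" by blast
  then obtain m where "agreeing y {..<m} \<subseteq> - closure A"
    using open_cantor_iff[of "- closure A"] by auto
  then have "agreeing y {..<m} \<inter> A = {}"
    using closure_subset by blast
  then show "\<exists>y\<in>agreeing z {..<n}. \<exists>m. agreeing y {..<m} \<inter> A = {}"
    using y by blast
next
  assume *: "\<forall>z n. \<exists>y\<in>agreeing z {..<n}. \<exists>m. agreeing y {..<m} \<inter> A = {}"
  have False if x: "x \<in> interior (closure A)" for x
  proof -
    obtain n where n: "agreeing x {..<n} \<subseteq> interior (closure A)"
      using x open_cantor_iff[of "interior (closure A)"] by auto
    obtain y m where y: "y \<in> agreeing x {..<n}" "agreeing y {..<m} \<inter> A = {}"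
      using * by blast
    have "agreeing y {..<m} \<inter> closure A = {}"
      using y(2) open_Int_closure_eq_empty[OF open_agreeing] by auto
    moreover have "y \<in> closure A"
      using y(1) n interior_subset by blast
    ultimately show False using agreeing_self[of y "{..<m}"] by blast
  qed
  then show "nowhere_dense A" by (auto simp: nowhere_dense_def)
qed

section \<open>Combinatorial description of meager sets\<close>

lemma nowhere_dense_Un:
  assumes "nowhere_dense A" "nowhere_dense (B :: (nat \<Rightarrow> bool) set)"
  shows "nowhere_dense (A \<union> B)"
  unfolding nowhere_dense_iff
proof (intro allI)
  fix z n
  obtain y m where y: "y \<in> agreeing z {..<n}" "agreeing y {..<m} \<inter> A = {}"
    using assms(1) unfolding nowhere_dense_iff by blast
  obtain y' m' where y': "y' \<in> agreeing y {..<max n m}" "agreeing y' {..<m'} \<inter> B = {}"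
    using assms(2) unfolding nowhere_dense_iff by blast
  have "y' \<in> agreeing z {..<n}"
    using agreeing_trans[OF y'(1) y(1)] by simp
  moreover have "x \<notin> A \<union> B" if x: "x \<in> agreeing y' {..<max m m'}" for x
  proof -
    have "y' \<in> agreeing y {..<m}"
      using agreeing_trans[OF y'(1) agreeing_self] by simp
    then have "x \<in> agreeing y {..<m}" "x \<in> agreeing y' {..<m'}"
      using agreeing_trans[OF x] by auto
    then show ?thesis using y(2) y'(2) by blast
  qed
  ultimately show "\<exists>y\<in>agreeing z {..<n}. \<exists>m. agreeing y {..<m} \<inter> (A \<union> B) = {}"
    by blast
qed

lemma nowhere_dense_UN_atMost:
  fixes F :: "nat \<Rightarrow> (nat \<Rightarrow> bool) set"
  assumes "\<And>k. nowhere_dense (F k)"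
  shows "nowhere_dense (\<Union>k\<le>n. F k)"
  by (induction n) (simp_all add: assms atMost_Suc nowhere_dense_Un)

text \<open>
  The block \<open>z\<close> must work for all ways to fill the first \<open>a\<close> coordinates. There are finitely many of
  these; they are treated one after another, each time extending the block found so far.
\<close>

lemma nowhere_dense_avoid:
  assumes "nowhere_dense A"
  obtains m z where "m > a" "agreeing z {a..<m} \<inter> A = {}"
proof -
  have "\<exists>m>a. \<exists>z. \<forall>x\<in>agreeing z {a..<m}. {i. i < a \<and> x i} \<in> P \<longrightarrow> x \<notin> A" if "finite P" for P
    using that
  proof (induction P)
    case empty
    then show ?case by auto
  next
    case (insert p P)
    then obtain m z where z: "m > a"
      "\<forall>x\<in>agreeing z {a..<m}. {i. i < a \<and> x i} \<in> P \<longrightarrow> x \<notin> A" by blast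
    obtain y m' where y: "y \<in> agreeing (\<lambda>i. if i < a then i \<in> p else z i) {..<m}"
      "agreeing y {..<m'} \<inter> A = {}"
      using assms unfolding nowhere_dense_iff by blast
    have "x \<notin> A" if x: "x \<in> agreeing y {a..<max m m'}" "{i. i < a \<and> x i} \<in> insert p P" for x
    proof (cases "{i. i < a \<and> x i} = p")
      case True
      have "x \<in> agreeing y {..<m'}"
      proof (rule agreeingI)
        fix i assume "i \<in> {..<m'}"
        show "x i = y i"
        proof (cases "i < a")
          case True
          then have "y i = (i \<in> p)" using agreeingD[OF y(1), of i] z(1) by simp
          then show ?thesis using True \<open>_ = p\<close> by blast
        next
          case False
          then show ?thesis using agreeingD[OF x(1), of i] \<open>i \<in> {..<m'}\<close> by simp
        qed
      qed
      then show ?thesis using y(2) by blast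
    next
      case False
      have "x \<in> agreeing z {a..<m}"
      proof (rule agreeingI)
        fix i assume "i \<in> {a..<m}"
        then show "x i = z i"
          using agreeingD[OF x(1), of i] agreeingD[OF y(1), of i] by (simp add: less_max_iff_disj)
      qed
      then show ?thesis using z(2) x(2) False by blast
    qed
    then show ?case
      using z(1) by (intro exI[of _ "max m m'"] conjI exI[of _ y]) auto
  qed
  from this[of "Pow {..<a}"] obtain m z
    where z: "m > a" "\<forall>x\<in>agreeing z {a..<m}. {i. i < a \<and> x i} \<in> Pow {..<a} \<longrightarrow> x \<notin> A"
    by auto
  then have "agreeing z {a..<m} \<inter> A = {}" by auto
  with z(1) show ?thesis by (rule that)
qed

text \<open>
  The index of the interval \<open>[d i, d (i + 1))\<close> that contains \<open>j\<close>. It is used to glue points from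
  pieces given on the intervals of a partition.
\<close>

definition block_index :: "(nat \<Rightarrow> nat) \<Rightarrow> nat \<Rightarrow> nat"
  where "block_index d j = (SOME i. d i \<le> j \<and> j < d (Suc i))"

lemma block_index_eq:
  assumes "strict_mono d" "d i \<le> j" "j < d (Suc i)"
  shows "block_index d j = i"
  unfolding block_index_def
proof (rule some_equality)
  fix k assume k: "d k \<le> j \<and> j < d (Suc k)"
  have "\<not> Suc k \<le> i" "\<not> Suc i \<le> k"
    using k assms strict_mono_less_eq[OF assms(1)]
    by (meson le_less_trans not_le order.strict_trans1)+
  then show "k = i" by linarith
qed (use assms in auto)

lemma block_index_bounds:
  fixes d :: "nat \<Rightarrow> nat"
  assumes "strict_mono d" "d 0 \<le> j"
  shows "d (block_index d j) \<le> j" "j < d (Suc (block_index d j))"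
proof -
  have fin: "finite {i. d i \<le> j}"
  proof (rule finite_subset)
    show "{i. d i \<le> j} \<subseteq> {..j}"
      using strict_mono_imp_increasing[OF assms(1)] le_trans by blast
  qed simp
  define i where "i = Max {i. d i \<le> j}"
  have i: "d i \<le> j" using Max_in[OF fin] assms(2) unfolding i_def by auto
  have "\<not> d (Suc i) \<le> j"
    using Max_ge[OF fin, of "Suc i"] unfolding i_def[symmetric] by auto
  then have j: "j < d (Suc i)" by simp
  from block_index_eq[OF assms(1) i j] show "d (block_index d j) \<le> j" "j < d (Suc (block_index d j))"
    using i j by auto
qed

text \<open>
  Talagrand's description of meager sets. If \<open>B\<close> is the union of nowhere dense \<open>F k\<close>, the \<open>i\<close>-th block
  is chosen by \<open>nowhere_dense_avoid\<close> so that agreement with \<open>z\<close> on it excludes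
  \<open>F 0 \<union> \<dots> \<union> F i\<close>; a point that agrees with \<open>z\<close> on infinitely many blocks is in no \<open>F k\<close>. The end points may
  be taken from the range of any prescribed sequence \<open>c\<close> because lengthening a block only helps; this
  is used to align the blocks with the blocks that code values of bounded functions.
\<close>

lemma meager_imp_blocks:
  fixes c :: "nat \<Rightarrow> nat"
  assumes "meager B" "strict_mono c"
  obtains e z where "strict_mono e" "e 0 = 0"
    "\<And>x. x \<in> B \<Longrightarrow> \<forall>\<^sub>\<infinity>i. x \<notin> agreeing z {c (e i)..<c (e (Suc i))}"
proof -
  obtain F where F: "\<And>n. nowhere_dense (F n)" "B = (\<Union>n::nat. F n)"
    using assms(1) unfolding meager_def by blast
  define Q where "Q i a m z \<longleftrightarrow> m > a \<and> agreeing z {c a..<c m} \<inter> (\<Union>k\<le>i. F k) = {}"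
    for i a m and z :: "nat \<Rightarrow> bool"
  have "\<exists>m z. Q i a m z" for i a :: nat
  proof -
    obtain m z where m: "m > c a" "agreeing z {c a..<m} \<inter> (\<Union>k\<le>i. F k) = {}"
      using nowhere_dense_avoid[OF nowhere_dense_UN_atMost[of F i]] F(1) by metis
    have "m \<le> c m" using strict_mono_imp_increasing[OF assms(2)] .
    then have "c a < c m" using m(1) by simp
    then have "m > a" using strict_mono_less[OF assms(2)] by simp
    moreover have "agreeing z {c a..<c m} \<inter> (\<Union>k\<le>i. F k) = {}"
      using m(2) agreeing_mono[of "{c a..<m}" "{c a..<c m}" z] \<open>m \<le> c m\<close> by auto
    ultimately show ?thesis unfolding Q_def by blast
  qed
  then obtain m w where "\<And>i a. Q i a (m i a) (w i a)"
    by metis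
  then have m: "m i a > a" "agreeing (w i a) {c a..<c (m i a)} \<inter> (\<Union>k\<le>i. F k) = {}" for i a
    unfolding Q_def by simp_all
  define e where "e = rec_nat 0 m"
  have e: "e 0 = 0" "e (Suc i) = m i (e i)" for i by (simp_all add: e_def)
  have mono_e: "strict_mono e" by (rule strict_mono_Suc_iff[THEN iffD2]) (simp add: e m(1))
  define d where "d i = c (e i)" for i
  have mono_d: "strict_mono d"
    using mono_e assms(2) by (auto simp: d_def strict_mono_def)
  define z where "z j = w (block_index d j) (e (block_index d j)) j" for j
  have "\<forall>\<^sub>\<infinity>i. x \<notin> agreeing z {c (e i)..<c (e (Suc i))}" if "x \<in> B" for x
  proof -
    obtain k where k: "x \<in> F k" using \<open>x \<in> B\<close> F(2) by blast
    have "x \<notin> agreeing z {c (e i)..<c (e (Suc i))}" if "i \<ge> k" for i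
    proof
      assume x: "x \<in> agreeing z {c (e i)..<c (e (Suc i))}"
      have "x \<in> agreeing (w i (e i)) {c (e i)..<c (m i (e i))}"
      proof (rule agreeingI)
        fix j assume j: "j \<in> {c (e i)..<c (m i (e i))}"
        then have "block_index d j = i"
          using block_index_eq[OF mono_d, of i j] by (simp add: d_def e)
        then show "x j = w i (e i) j"
          using agreeingD[OF x, of j] j by (simp add: z_def e)
      qed
      then show False using m(2)[of i "e i"] k that by blast
    qed
    then show ?thesis unfolding MOST_nat_le by blast
  qed
  with mono_e e(1) show ?thesis by (rule that)
qed

lemma meager_imp_intervals:
  assumes "meager B"
  obtains e z where "strict_mono e" "e 0 = (0 :: nat)"
    "\<And>x. x \<in> B \<Longrightarrow> \<forall>\<^sub>\<infinity>i. x \<notin> agreeing z {e i..<e (Suc i)}"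
proof (rule meager_imp_blocks[OF assms])
  show "strict_mono (\<lambda>i :: nat. i)" by (simp add: strict_mono_def)
qed (rule that)

text \<open>
  As \<open>D n\<close> lies above \<open>n\<close>, the conditions for large \<open>n\<close> do not interfere with a given finite initial
  segment. So every basic open set contains a point, and hence a basic open set, that meets one of the
  conditions with index at least \<open>N\<close>.
\<close>

lemma meager_avoiding:
  fixes z :: "nat \<Rightarrow> nat \<Rightarrow> bool"
  assumes "\<And>n. finite (D n)" "\<And>n. D n \<subseteq> {n..}"
  shows "meager {x. \<forall>\<^sub>\<infinity>n. x \<notin> agreeing (z n) (D n)}"
  unfolding meager_def
proof (intro exI conjI allI)
  let ?F = "\<lambda>N. {x. \<forall>n\<ge>N. x \<notin> agreeing (z n) (D n)}"
  show "{x. \<forall>\<^sub>\<infinity>n. x \<notin> agreeing (z n) (D n)} = (\<Union>N. ?F N)"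
    by (auto simp: MOST_nat_le)
  show "nowhere_dense (?F N)" for N
    unfolding nowhere_dense_iff
  proof (intro allI)
    fix y k
    define n where "n = max N k"
    define y' where "y' i = (if i \<in> D n then z n i else y i)" for i
    obtain m where m: "D n \<subseteq> {..<m}"
      using assms(1) finite_nat_iff_bounded by blast
    have "y' \<in> agreeing y {..<k}"
      using assms(2)[of n] by (auto simp: y'_def n_def agreeing_def)
    moreover have "x \<in> agreeing (z n) (D n)" if "x \<in> agreeing y' {..<m}" for x
      using that m unfolding agreeing_def y'_def by (simp add: subset_iff)
    then have "agreeing y' {..<m} \<inter> ?F N = {}"
      using max.cobounded1[of N k] unfolding n_def by blast
    ultimately show "\<exists>y'\<in>agreeing y {..<k}. \<exists>m. agreeing y' {..<m} \<inter> ?F N = {}"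
      by blast
  qed
qed

lemma meager_subset: "meager A \<Longrightarrow> B \<subseteq> A \<Longrightarrow> meager (B :: 'a::topological_space set)"
  unfolding meager_def
proof (elim exE conjE)
  fix F assume F: "\<forall>n. nowhere_dense (F n)" "A = (\<Union>n::nat. F n)" and "B \<subseteq> A"
  have "nowhere_dense (F n \<inter> B)" for n
    using F(1) interior_mono[OF closure_mono[of "F n \<inter> B" "F n"]]
    by (auto simp: nowhere_dense_def)
  moreover have "B = (\<Union>n. F n \<inter> B)" using F(2) \<open>B \<subseteq> A\<close> by auto
  ultimately show "\<exists>F. (\<forall>n. nowhere_dense (F n)) \<and> B = (\<Union>n::nat. F n)"
    by (intro exI[of _ "\<lambda>n. F n \<inter> B"]) simp
qed

lemma meager_Un: "meager A \<Longrightarrow> meager B \<Longrightarrow> meager (A \<union> B :: 'a::topological_space set)"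
  unfolding meager_def
proof (elim exE conjE)
  fix F G :: "nat \<Rightarrow> 'a set"
  assume "\<forall>n. nowhere_dense (F n)" "A = (\<Union>n. F n)" "\<forall>n. nowhere_dense (G n)" "B = (\<Union>n. G n)"
  then have A: "A = (\<Union>n. F n)" and B: "B = (\<Union>n. G n)" and FG: "nowhere_dense (F n)" "nowhere_dense (G n)" for n
    by blast+
  define H where "H n = (if even n then F (n div 2) else G (n div 2))" for n
  have F: "F n = H (2 * n)" and G: "G n = H (2 * n + 1)" for n
    by (simp_all add: H_def)
  have "A \<union> B = (\<Union>n. H n)"
  proof (intro equalityI Un_least)
    show "A \<subseteq> (\<Union>n. H n)" "B \<subseteq> (\<Union>n. H n)"
      unfolding A B F G by (rule UN_least, rule UN_upper, rule UNIV_I)+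
    show "(\<Union>n. H n) \<subseteq> A \<union> B"
      unfolding A B by (rule UN_least) (auto simp: H_def)
  qed
  moreover have "nowhere_dense (H n)" for n
    by (simp add: H_def FG)
  ultimately show "\<exists>H. (\<forall>n. nowhere_dense (H n)) \<and> A \<union> B = (\<Union>n::nat. H n)"
    by blast
qed

lemma meager_countable_Union:
  assumes "countable \<J>" "\<And>A. A \<in> \<J> \<Longrightarrow> meager (A :: 'a::topological_space set)"
  shows "meager (\<Union>\<J>)"
proof -
  from assms(2) have "\<forall>A\<in>\<J>. \<exists>F :: nat \<Rightarrow> 'a set. (\<forall>n. nowhere_dense (F n)) \<and> A = (\<Union>n. F n)"
    by (simp add: meager_def)
  then obtain F :: "'a set \<Rightarrow> nat \<Rightarrow> 'a set"
    where F: "\<And>A n. A \<in> \<J> \<Longrightarrow> nowhere_dense (F A n)" "\<And>A. A \<in> \<J> \<Longrightarrow> A = (\<Union>n. F A n)"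
    by metis
  have nd0: "nowhere_dense ({} :: 'a set)" by (simp add: nowhere_dense_def)
  define G where "G m = (case prod_decode m of (i, n) \<Rightarrow>
    if from_nat_into \<J> i \<in> \<J> then F (from_nat_into \<J> i) n else {})" for m
  have "nowhere_dense (G m)" for m
    by (auto simp: G_def nd0 F(1) split: prod.split)
  moreover have "\<Union>\<J> = (\<Union>m. G m)"
  proof (intro equalityI subsetI)
    fix x assume "x \<in> \<Union>\<J>"
    then obtain A where A: "A \<in> \<J>" "x \<in> A" by blast
    then obtain n where n: "x \<in> F A n" using F(2) by blast
    obtain i where "from_nat_into \<J> i = A" using from_nat_into_surj[OF assms(1) A(1)] by blast
    then have "x \<in> G (prod_encode (i, n))" using A n by (simp add: G_def)
    then show "x \<in> (\<Union>m. G m)" by blast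
  next
    fix x assume "x \<in> (\<Union>m. G m)"
    then obtain m where "x \<in> G m" by blast
    then obtain i n where "from_nat_into \<J> i \<in> \<J>" "x \<in> F (from_nat_into \<J> i) n"
      by (auto simp: G_def split: prod.splits if_splits)
    then show "x \<in> \<Union>\<J>" using F(2) by blast
  qed
  ultimately show ?thesis unfolding meager_def by blast
qed

text \<open>
  The Baire category theorem for the Cantor space: the point \<open>z\<close> of \<open>meager_imp_blocks\<close> agrees with
  itself on every block.
\<close>

lemma not_meager_UNIV: "\<not> meager (UNIV :: (nat \<Rightarrow> bool) set)"
proof
  assume "meager (UNIV :: (nat \<Rightarrow> bool) set)"
  then show False
  proof (rule meager_imp_blocks)
    show "strict_mono (\<lambda>i::nat. i)" by (simp add: strict_mono_def)
    fix e :: "nat \<Rightarrow> nat" and z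
    assume "\<And>x. x \<in> UNIV \<Longrightarrow> \<forall>\<^sub>\<infinity>i. x \<notin> agreeing z {e i..<e (Suc i)}"
    from this[of z] show False by simp
  qed
qed

lemma meager_singleton: "meager {a :: nat \<Rightarrow> bool}"
  by (rule meager_subset[OF meager_avoiding[of "\<lambda>n. {n}" "\<lambda>n i. \<not> a i"]]) (auto simp: agreeing_def)

section \<open>Cardinal characteristics as norms of relational systems\<close>

text \<open>
  Closure under subsets identifies \<open>add\<close> and \<open>non\<close> with norms of the systems \<open>(\<I>, \<I>, \<subseteq>)\<close> and
  \<open>(UNIV, \<I>, \<in>)\<close>; the other two conditions make the classes of sets nonempty whose least size is
  taken.
\<close>

definition proper_ideal :: "'a set set \<Rightarrow> bool"
  where "proper_ideal \<I> \<longleftrightarrow> (\<forall>A\<in>\<I>. \<forall>B. B \<subseteq> A \<longrightarrow> B \<in> \<I>) \<and> (\<forall>x. {x} \<in> \<I>) \<and> UNIV \<notin> \<I>"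

lemma proper_idealD:
  assumes "proper_ideal \<I>"
  shows "A \<in> \<I> \<Longrightarrow> B \<subseteq> A \<Longrightarrow> B \<in> \<I>" "{x} \<in> \<I>" "UNIV \<notin> \<I>" "A \<in> \<I> \<Longrightarrow> \<exists>x. x \<notin> A"
  using assms unfolding proper_ideal_def by (blast, blast, blast, metis UNIV_eq_I)

lemma cov_ideal_eq: "cov_ideal \<I> = dominating_card UNIV \<I> (\<in>)"
  unfolding cov_ideal_def dominating_card_def by (rule arg_cong[where f = min_card]) blast

lemma cof_ideal_eq: "cof_ideal \<I> = dominating_card \<I> \<I> (\<subseteq>)"
  unfolding cof_ideal_def dominating_card_def ..

lemma non_ideal_eq: assumes "proper_ideal \<I>" shows "non_ideal \<I> = bounding_card UNIV \<I> (\<in>)"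
proof -
  have "A \<notin> \<I> \<longleftrightarrow> \<not> (\<exists>B\<in>\<I>. \<forall>x\<in>A. x \<in> B)" for A
    using proper_idealD(1)[OF assms] by blast
  then show ?thesis unfolding non_ideal_def bounding_card_def by simp
qed

lemma add_ideal_eq: assumes "proper_ideal \<I>" shows "add_ideal \<I> = bounding_card \<I> \<I> (\<subseteq>)"
proof -
  have "\<Union>\<J> \<notin> \<I> \<longleftrightarrow> \<not> (\<exists>B\<in>\<I>. \<forall>A\<in>\<J>. A \<subseteq> B)" for \<J>
    using proper_idealD(1)[OF assms] by (metis Sup_le_iff Union_upper)
  then show ?thesis unfolding add_ideal_def bounding_card_def by simp
qed

lemma bounding_number_eq: "bounding_number = bounding_card UNIV UNIV (\<le>\<^sup>*)"
  by (simp add: bounding_number_def bounding_card_def)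

lemma dominating_number_eq: "dominating_number = dominating_card UNIV UNIV (\<le>\<^sup>*)"
  by (simp add: dominating_number_def dominating_card_def)

lemma b_eq_eq: "b_eq b =
    bounding_card (bounded_functions b) (interval_partitions \<times> bounded_functions b) (\<sqsubset>\<^sup>\<bullet>)"
  by (simp add: b_eq_def bounding_card_def)

lemma d_eq_eq: "d_eq b =
    dominating_card (bounded_functions b) (interval_partitions \<times> bounded_functions b) (\<sqsubset>\<^sup>\<bullet>)"
  unfolding d_eq_def dominating_card_def by (rule arg_cong[where f = min_card]) auto

lemma tukey_point: "proper_ideal \<I> \<Longrightarrow> tukey UNIV \<I> (\<in>) \<I> \<I> (\<subseteq>)"
  by (rule tukeyI[of _ "\<lambda>x. {x}" _ _ "\<lambda>B. B"]) (simp_all add: proper_idealD(2))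

text \<open>
  A point outside \<open>B\<close> is outside every subset of \<open>B\<close>. Together with \<open>tukey_point\<close> this puts
  \<open>cov\<close> and \<open>non\<close> between \<open>add\<close> and \<open>cof\<close>.
\<close>

lemma tukey_point_dual: assumes "proper_ideal \<I>" shows "tukey \<I> UNIV (\<lambda>A x. x \<notin> A) \<I> \<I> (\<subseteq>)"
proof (rule tukeyI_ex[of _ "\<lambda>A. A"])
  fix B assume "B \<in> \<I>"
  then obtain x where "x \<notin> B" using proper_idealD(4)[OF assms] by blast
  then show "\<exists>x\<in>UNIV. \<forall>A\<in>\<I>. A \<subseteq> B \<longrightarrow> x \<notin> A" by blast
qed

lemma tukey_from_ideal:
  assumes "proper_ideal \<I>" "tukey X Y R \<I> \<I> (\<subseteq>)" "\<And>y. y \<in> Y \<Longrightarrow> \<exists>x\<in>X. \<not> R x y"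
  shows "add_ideal \<I> \<le>o bounding_card X Y R" "dominating_card X Y R \<le>o cof_ideal \<I>"
  unfolding add_ideal_eq[OF assms(1)] cof_ideal_eq
  using tukey_bounding_card[OF assms(2,3)] tukey_dominating_card[OF assms(2)] by auto

lemma tukey_from_points:
  assumes "proper_ideal \<I>" "tukey UNIV \<I> (\<in>) X Y R" "\<And>x. x \<in> X \<Longrightarrow> \<exists>y\<in>Y. R x y"
  shows "bounding_card X Y R \<le>o non_ideal \<I>" "cov_ideal \<I> \<le>o dominating_card X Y R"
  unfolding non_ideal_eq[OF assms(1)] cov_ideal_eq
  using tukey_bounding_card[OF assms(2)] tukey_dominating_card[OF assms(2,3)]
    proper_idealD(4)[OF assms(1)] by auto

lemma bounding_card_dual_points: "bounding_card \<I> UNIV (\<lambda>A x. x \<notin> A) = cov_ideal \<I>"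
  unfolding cov_ideal_eq dominating_card_eq_dual by simp

lemma dominating_card_dual_points:
  "proper_ideal \<I> \<Longrightarrow> dominating_card \<I> UNIV (\<lambda>A x. x \<notin> A) = non_ideal \<I>"
  unfolding non_ideal_eq dominating_card_eq_dual by simp

lemma ideal_trivial_inequalities:
  assumes "proper_ideal \<I>"
  shows "add_ideal \<I> \<le>o non_ideal \<I>" "cov_ideal \<I> \<le>o cof_ideal \<I>"
    and "add_ideal \<I> \<le>o cov_ideal \<I>" "non_ideal \<I> \<le>o cof_ideal \<I>"
proof -
  show "add_ideal \<I> \<le>o non_ideal \<I>" "cov_ideal \<I> \<le>o cof_ideal \<I>"
    unfolding non_ideal_eq[OF assms(1)] cov_ideal_eq
    using tukey_from_ideal[OF assms tukey_point[OF assms]] proper_idealD(4)[OF assms] by blast+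
  have "\<exists>A\<in>\<I>. \<not> x \<notin> A" for x
    using proper_idealD(2)[OF assms, of x] by blast
  then show "add_ideal \<I> \<le>o cov_ideal \<I>" "non_ideal \<I> \<le>o cof_ideal \<I>"
    using tukey_from_ideal[OF assms tukey_point_dual[OF assms]]
    by (simp_all add: bounding_card_dual_points dominating_card_dual_points[OF assms])
qed

lemma proper_ideal_meager: "proper_ideal meager_ideal"
  unfolding proper_ideal_def meager_ideal_def
  using meager_subset meager_singleton not_meager_UNIV by blast

section \<open>Meager sets and domination\<close>

text \<open>
  When a point is copied from \<open>z\<close> on the intervals with index in \<open>T\<close>, sparseness leaves a free interval
  after each copied one.
\<close>

lemma infinite_sparse_subset:
  assumes "infinite (S :: nat set)"
  obtains T where "T \<subseteq> S" "infinite T" "\<And>k. k \<in> T \<Longrightarrow> Suc k \<notin> T"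
proof -
  have "S = {k\<in>S. even k} \<union> {k\<in>S. odd k}" by blast
  then have "infinite {k\<in>S. even k} \<or> infinite {k\<in>S. odd k}"
    using assms by (metis finite_Un)
  then show ?thesis
    using that[of "{k\<in>S. even k}"] that[of "{k\<in>S. odd k}"] by auto
qed

lemma infinitely_often_contradiction:
  assumes "infinite T" "\<And>i. i \<in> T \<Longrightarrow> y \<in> A i" "\<forall>\<^sub>\<infinity>i. y \<notin> A (i :: nat)"
  shows False
proof -
  obtain N where "\<forall>i\<ge>N. y \<notin> A i" using assms(3) unfolding MOST_nat_le by blast
  moreover obtain i where "i \<in> T" "i \<ge> N"
    using assms(1) by (meson finite_nat_set_iff_bounded_le nat_le_linear)
  ultimately show False using assms(2) by blast
qed

lemma not_MOST_infinite: "\<not> (\<forall>\<^sub>\<infinity>n. P n) \<Longrightarrow> infinite {n. \<not> P n}"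
  by (simp add: eventually_cofinite)

text \<open>
  The meager set of \<open>f\<close> consists of the points that take the value \<open>True\<close> in almost every
  \<open>[k, F f k]\<close>, where \<open>F f\<close> is a monotone function above \<open>f\<close>. If \<open>f k\<close> exceeds the end of the block
  of \<open>B\<close> with index \<open>k\<close> for infinitely many \<open>k\<close>, then a point that copies \<open>z\<close> on sparsely many of these
  blocks and is \<open>True\<close> elsewhere has this property, but it is not in \<open>B\<close>.
\<close>

lemma tukey_le_star_meager: "tukey UNIV UNIV (\<le>\<^sup>*) meager_ideal meager_ideal (\<subseteq>)"
proof -
  define F :: "(nat \<Rightarrow> nat) \<Rightarrow> nat \<Rightarrow> nat" where "F f k = k + Max (f ` {..k})" for f k
  have F: "f j \<le> F f k" if "j \<le> k" for f j k
    using that by (auto simp: F_def intro!: trans_le_add2 Max_ge)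
  define \<phi> where "\<phi> f = {x. \<forall>\<^sub>\<infinity>k. x \<notin> agreeing (\<lambda>_. False) {k..F f k}}" for f
  show ?thesis
  proof (rule tukeyI_ex[of _ \<phi>])
    show "\<phi> f \<in> meager_ideal" for f
      unfolding \<phi>_def meager_ideal_def by (rule CollectI, rule meager_avoiding) auto
  next
    fix B assume "B \<in> meager_ideal"
    then have "meager B" by (simp add: meager_ideal_def)
    then obtain e z where e: "strict_mono e" "e 0 = 0"
      and B: "\<And>x. x \<in> B \<Longrightarrow> \<forall>\<^sub>\<infinity>i. x \<notin> agreeing z {e i..<e (Suc i)}"
      by (rule meager_imp_intervals) blast
    have "f \<le>\<^sup>* (\<lambda>k. e (Suc k))" if sub: "\<phi> f \<subseteq> B" for f
    proof (rule ccontr)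
      assume "\<not> f \<le>\<^sup>* (\<lambda>k. e (Suc k))"
      then have "infinite {k. \<not> f k \<le> e (Suc k)}"
        unfolding le_star_def by (rule not_MOST_infinite)
      then obtain T where T: "T \<subseteq> {k. \<not> f k \<le> e (Suc k)}" "infinite T"
        "\<And>k. k \<in> T \<Longrightarrow> Suc k \<notin> T"
        by (rule infinite_sparse_subset) blast
      define y where "y i = (if block_index e i \<in> T then z i else True)" for i
      have "y \<notin> agreeing (\<lambda>_. False) {k..F f k}" for k
      proof -
        have "\<exists>i\<in>{k..F f k}. y i"
        proof (cases "block_index e k \<in> T")
          case False
          then show ?thesis by (auto simp: y_def F_def intro!: bexI[of _ k])
        next
          case True
          define j where "j = block_index e k"
          have j: "e j \<le> k" "k < e (Suc j)"
            using block_index_bounds[OF e(1)] by (auto simp: j_def e(2))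
          have "block_index e (e (Suc j)) = Suc j"
            by (rule block_index_eq[OF e(1)]) (use strict_monoD[OF e(1)] in auto)
          then have "y (e (Suc j))"
            using T(3)[OF True] by (simp add: y_def j_def)
          moreover have "j \<le> k"
            using strict_mono_imp_increasing[OF e(1), of j] j(1) by simp
          then have "f j \<le> F f k" by (rule F)
          then have "e (Suc j) \<le> F f k"
            using T(1) True by (auto simp: j_def)
          \<comment> \<open>The first position after the copied block is free, and it is reached before \<open>F f k\<close>.\<close>
          ultimately show ?thesis
            using j(2) by (intro bexI[of _ "e (Suc j)"]) auto
        qed
        then show ?thesis by (auto simp: agreeing_def)
      qed
      then have "y \<in> \<phi> f" by (simp add: \<phi>_def)
      then have avoid: "\<forall>\<^sub>\<infinity>i. y \<notin> agreeing z {e i..<e (Suc i)}"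
        using sub by (intro B) blast
      have "y \<in> agreeing z {e i..<e (Suc i)}" if "i \<in> T" for i
        by (rule agreeingI) (use block_index_eq[OF e(1), of i] that in \<open>simp add: y_def\<close>)
      from T(2) this avoid show False by (rule infinitely_often_contradiction)
    qed
    then show "\<exists>g\<in>UNIV. \<forall>f\<in>UNIV. \<phi> f \<subseteq> B \<longrightarrow> f \<le>\<^sup>* g" by blast
  qed
qed

text \<open>
  A point is turned into the function that sends \<open>n\<close> to the next position of \<open>True\<close>. If this
  function is bounded by \<open>g\<close>, then long blocks of \<open>False\<close> starting at \<open>n\<close> occur only finitely often.
  Points that are eventually \<open>False\<close>, for which there is no next position, form a meager set of their own.
\<close>

lemma tukey_point_meager_le_star: "tukey UNIV meager_ideal (\<in>) UNIV UNIV (\<le>\<^sup>*)"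
proof -
  define \<phi> :: "(nat \<Rightarrow> bool) \<Rightarrow> nat \<Rightarrow> nat" where "\<phi> x n = (LEAST i. n \<le> i \<and> x i)" for x n
  have "meager {x. \<phi> x \<le>\<^sup>* g}" for g
  proof (rule meager_subset)
    show "meager ({x. \<forall>\<^sub>\<infinity>n. x \<notin> agreeing (\<lambda>_. True) {n}} \<union>
        {x. \<forall>\<^sub>\<infinity>n. x \<notin> agreeing (\<lambda>_. False) {n..g n}})"
      by (intro meager_Un meager_avoiding) auto
    show "{x. \<phi> x \<le>\<^sup>* g} \<subseteq> {x. \<forall>\<^sub>\<infinity>n. x \<notin> agreeing (\<lambda>_. True) {n}} \<union>
        {x. \<forall>\<^sub>\<infinity>n. x \<notin> agreeing (\<lambda>_. False) {n..g n}}"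
    proof
      fix x assume "x \<in> {x. \<phi> x \<le>\<^sup>* g}"
      then have le: "\<forall>\<^sub>\<infinity>n. \<phi> x n \<le> g n" by (simp add: le_star_def)
      show "x \<in> {x. \<forall>\<^sub>\<infinity>n. x \<notin> agreeing (\<lambda>_. True) {n}} \<union>
        {x. \<forall>\<^sub>\<infinity>n. x \<notin> agreeing (\<lambda>_. False) {n..g n}}"
      proof (cases "\<forall>\<^sub>\<infinity>n. \<not> x n")
        case True
        then show ?thesis by (simp add: agreeing_def)
      next
        case False
        have "n \<le> \<phi> x n \<and> x (\<phi> x n)" for n
        proof -
          obtain i where "n \<le> i \<and> x i"
            using False unfolding MOST_nat_le by blast
          then show ?thesis unfolding \<phi>_def by (rule LeastI)
        qed
        then have "x \<notin> agreeing (\<lambda>_. False) {n..g n}" if "\<phi> x n \<le> g n" for n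
          using that agreeingD[of x "\<lambda>_. False" "{n..g n}" "\<phi> x n"] by auto
        with le have "\<forall>\<^sub>\<infinity>n. x \<notin> agreeing (\<lambda>_. False) {n..g n}"
          by (rule eventually_mono)
        then show ?thesis by simp
      qed
    qed
  qed
  then show ?thesis
    by (intro tukeyI[of _ \<phi> _ _ "\<lambda>g. {x. \<phi> x \<le>\<^sup>* g}"]) (auto simp: meager_ideal_def)
qed

section \<open>Coding bounded functions by points of the Cantor space\<close>

definition block_start :: "(nat \<Rightarrow> nat) \<Rightarrow> nat \<Rightarrow> nat"
  where "block_start b k = (\<Sum>j<k. b j)"

definition block :: "(nat \<Rightarrow> nat) \<Rightarrow> nat \<Rightarrow> nat set"
  where "block b k = {block_start b k..<block_start b (Suc k)}"

definition word_number :: "nat \<Rightarrow> bool list \<Rightarrow> nat"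
  where "word_number w = (SOME f. bij_betw f {l. length l = w} {..<2 ^ w})"

text \<open>
  A point of the Cantor space codes a function below \<open>b\<close>. The value at \<open>k\<close> is read from a block of
  \<open>b k\<close> bits, which is long enough as \<open>b k \<le> 2 ^ b k\<close>, and reduced modulo \<open>b k\<close>. So each value
  has probability at least \<open>1 / (2 b k)\<close>, and the values for different \<open>k\<close> are independent. In this
  way category and measure on the product of \<open>b\<close> are pulled back to the Cantor space.
\<close>

definition decode :: "(nat \<Rightarrow> nat) \<Rightarrow> (nat \<Rightarrow> bool) \<Rightarrow> nat \<Rightarrow> nat"
  where "decode b x k =
    word_number (b k) (map x [block_start b k..<block_start b (Suc k)]) mod b k"

lemma bij_word_number: "bij_betw (word_number w) {l. length l = w} {..<2 ^ w}"
proof -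
  have fin: "finite {l :: bool list. length l = w}" "card {l :: bool list. length l = w} = 2 ^ w"
    using finite_lists_length_eq[of "UNIV :: bool set" w] card_lists_length_eq[of "UNIV :: bool set" w]
    by simp_all
  have "\<exists>f. bij_betw f {l :: bool list. length l = w} {..<2 ^ w :: nat}"
    using ex_bij_betw_finite_nat[OF fin(1)] unfolding fin(2) atLeast0LessThan .
  then show ?thesis unfolding word_number_def by (rule someI_ex)
qed

text \<open>
  Reduction modulo \<open>m\<close> distributes \<open>N\<close> numbers evenly up to a factor of two.
\<close>

lemma card_residue_class:
  fixes m N v :: nat
  assumes "v < m" "m \<le> N"
  shows "N \<le> 2 * m * card {i. i < N \<and> i mod m = v}"
proof -
  have "(\<lambda>q. v + m * q) ` {..<N div m} \<subseteq> {i. i < N \<and> i mod m = v}"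
  proof (intro subsetI)
    fix i assume "i \<in> (\<lambda>q. v + m * q) ` {..<N div m}"
    then obtain q where q: "q < N div m" "i = v + m * q" by auto
    have "m * q + m \<le> m * (N div m)"
      using q(1) by (metis Suc_leI add.commute mult_Suc_right mult_le_mono2)
    also have "\<dots> \<le> N" by simp
    finally show "i \<in> {i. i < N \<and> i mod m = v}"
      using assms q(2) by simp
  qed
  then have "card ((\<lambda>q. v + m * q) ` {..<N div m}) \<le> card {i. i < N \<and> i mod m = v}"
    by (intro card_mono) auto
  moreover have "card ((\<lambda>q. v + m * q) ` {..<N div m}) = N div m"
    using assms by (subst card_image) (auto simp: inj_on_def)
  ultimately have *: "N div m \<le> card {i. i < N \<and> i mod m = v}" by simp
  have "1 \<le> N div m" using assms by (simp add: Suc_le_eq div_greater_zero_iff)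
  then have "m \<le> m * (N div m)" by simp
  moreover have "N = m * (N div m) + N mod m" "N mod m < m" using assms by simp_all
  ultimately have "N \<le> 2 * (m * (N div m))" by linarith
  also have "\<dots> \<le> 2 * (m * card {i. i < N \<and> i mod m = v})"
    using * by simp
  finally show ?thesis by (simp add: mult.assoc)
qed

lemma card_word_residue:
  assumes "v < m"
  shows "2 ^ m \<le> 2 * m * card {l. length l = m \<and> word_number m l mod m = v}"
proof -
  have "bij_betw (word_number m) {l \<in> {l. length l = m}. word_number m l mod m = v}
      {i \<in> {..<2 ^ m}. i mod m = v}"
  proof (rule bij_betw_subset[OF bij_word_number, of _ m])
    show "word_number m ` {l \<in> {l. length l = m}. word_number m l mod m = v} =
        {i \<in> {..<2 ^ m}. i mod m = v}"
      using bij_betw_imp_surj_on[OF bij_word_number, of m] by auto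
  qed auto
  from bij_betw_same_card[OF this]
  have "card {l. length l = m \<and> word_number m l mod m = v} = card {i. i < 2 ^ m \<and> i mod m = v}"
    by simp
  moreover have "m \<le> 2 ^ m" by (simp add: less_imp_le)
  ultimately show ?thesis using card_residue_class[OF assms, of "2 ^ m"] by simp
qed

lemma block_start_Suc: "block_start b (Suc k) = block_start b k + b k"
  by (simp add: block_start_def)

lemma strict_mono_block_start: "(\<And>k. b k \<ge> 1) \<Longrightarrow> strict_mono (block_start b)"
  by (simp add: strict_mono_Suc_iff block_start_Suc less_le_trans[OF zero_less_one])

lemma decode_cong: "x \<in> agreeing y (block b k) \<Longrightarrow> decode b x k = decode b y k"
proof -
  assume "x \<in> agreeing y (block b k)"
  then have "map x [block_start b k..<block_start b (Suc k)] = map y [block_start b k..<block_start b (Suc k)]"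
    by (intro map_cong[OF refl] agreeingD) (auto simp: block_def)
  then show ?thesis by (simp only: decode_def)
qed

lemma decode_bounded: "(\<And>k. b k \<ge> 1) \<Longrightarrow> decode b x \<in> bounded_functions b"
  unfolding bounded_functions_def by (auto simp: decode_def less_le_trans[OF zero_less_one])

lemma decode_surj:
  assumes "\<And>k. b k \<ge> 1" "h \<in> bounded_functions b"
  obtains z where "decode b z = h"
proof -
  have "\<exists>l. length l = b k \<and> word_number (b k) l mod b k = h k" for k
  proof (rule ccontr)
    assume no: "\<not> (\<exists>l. length l = b k \<and> word_number (b k) l mod b k = h k)"
    have "h k < b k" using assms(2) by (auto simp: bounded_functions_def)
    from card_word_residue[OF this] have "{l. length l = b k \<and> word_number (b k) l mod b k = h k} \<noteq> {}"
      by (metis card.empty mult_0_right not_one_le_zero one_le_numeral one_le_power le_trans)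
    with no show False by blast
  qed
  then obtain l where l: "\<And>k. length (l k) = b k" "\<And>k. word_number (b k) (l k) mod b k = h k"
    by metis
  let ?c = "block_start b"
  define z where "z j = l (block_index ?c j) ! (j - ?c (block_index ?c j))" for j
  have "map z [?c k..<?c (Suc k)] = l k" for k
  proof (rule nth_equalityI)
    show "length (map z [?c k..<?c (Suc k)]) = length (l k)" by (simp add: block_start_Suc l(1))
    fix i assume i: "i < length (map z [?c k..<?c (Suc k)])"
    then have "block_index ?c (?c k + i) = k"
      by (intro block_index_eq strict_mono_block_start assms(1)) auto
    then show "map z [?c k..<?c (Suc k)] ! i = l k ! i"
      using i by (simp add: z_def)
  qed
  then have "decode b z = h" by (intro ext) (simp only: decode_def l)
  then show ?thesis by (rule that)
qed

lemma decode_avoid: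
  assumes "\<And>k. b k \<ge> 1"
  obtains z where "\<And>k. b k \<ge> 2 \<Longrightarrow> decode b z k \<noteq> h k"
proof -
  \<comment> \<open>Where \<open>b k = 1\<close> the only available value is \<open>0\<close>.\<close>
  define h' where "h' k = (if h k = 0 \<and> b k \<ge> 2 then 1 else 0 :: nat)" for k
  have "h' \<in> bounded_functions b"
    using less_le_trans[OF zero_less_one assms] by (simp add: h'_def bounded_functions_def)
  then obtain z where z: "decode b z = h'" using decode_surj assms by metis
  have "decode b z k \<noteq> h k" if "b k \<ge> 2" for k
    using that by (auto simp: z h'_def)
  then show ?thesis by (rule that)
qed

lemma interval_partition_ge:
  assumes "I \<in> interval_partitions" "k \<in> I n"
  shows "n \<le> k"
  using assms(2)
proof (induction n arbitrary: k)
  case (Suc n)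
  obtain i j where "i \<le> j" "I n = {i..j}"
    using assms(1) unfolding interval_partitions_def by blast
  then have i: "i \<in> I n" by simp
  then have "i < k"
    using assms(1) Suc.prems lessI[of n] unfolding interval_partitions_def mem_Collect_eq by blast
  then show ?case using Suc.IH[OF i] by simp
qed auto

lemma finite_interval_partition: assumes "I \<in> interval_partitions" shows "finite (I n)"
proof -
  obtain i j where "I n = {i..j}" using assms unfolding interval_partitions_def by blast
  then show ?thesis by simp
qed

lemma strict_mono_partition:
  assumes "strict_mono e" "e 0 = (0 :: nat)"
  shows "(\<lambda>i. {e i..<e (Suc i)}) \<in> interval_partitions"
  unfolding interval_partitions_def
proof (intro CollectI conjI allI impI ballI)
  fix n
  have "e n < e (Suc n)" using assms(1) strict_monoD by blast
  then show "\<exists>i j. i \<le> j \<and> {e n..<e (Suc n)} = {i..j}"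
    by (intro exI[of _ "e n"] exI[of _ "e (Suc n) - 1"]) auto
next
  fix m n x y assume "m < n" "x \<in> {e m..<e (Suc m)}" "y \<in> {e n..<e (Suc n)}"
  moreover have "e (Suc m) \<le> e n"
    using assms(1) \<open>m < n\<close> by (simp add: strict_mono_less_eq)
  ultimately show "x < y" by simp
next
  have "j \<in> {e (block_index e j)..<e (Suc (block_index e j))}" for j
    using block_index_bounds[OF assms(1)] assms(2) by simp
  then show "(\<Union>i. {e i..<e (Suc i)}) = UNIV" by blast
qed

lemma le_block_start: "(\<And>k. b k \<ge> 1) \<Longrightarrow> k \<le> block_start b k"
  using strict_mono_imp_increasing[OF strict_mono_block_start] by blast

text \<open>
  For a given \<open>(I, h)\<close> some \<open>z\<close> codes a function that differs from \<open>h\<close> wherever \<open>b k \<ge> 2\<close>. A point whose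
  function meets \<open>h\<close> in almost every \<open>I n\<close> disagrees with \<open>z\<close> on almost every union of the blocks of
  \<open>I n\<close>, and such points form a meager set.
\<close>

lemma tukey_point_meager_eq:
  assumes b: "\<And>k. b k \<ge> 1" and b2: "\<forall>\<^sub>\<infinity>k. b k \<ge> 2"
  shows "tukey UNIV meager_ideal (\<in>)
    (bounded_functions b) (interval_partitions \<times> bounded_functions b) (\<sqsubset>\<^sup>\<bullet>)"
proof -
  have "meager {x. decode b x \<sqsubset>\<^sup>\<bullet> (I, h)}" if I: "I \<in> interval_partitions" for I h
  proof -
    obtain z where z: "\<And>k. b k \<ge> 2 \<Longrightarrow> decode b z k \<noteq> h k" using decode_avoid b by metis
    define D where "D n = (\<Union>k\<in>I n. block b k)" for n
    have "meager {x. \<forall>\<^sub>\<infinity>n. x \<notin> agreeing z (D n)}"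
    proof (rule meager_avoiding)
      show "finite (D n)" for n
        by (simp add: D_def finite_interval_partition[OF I] block_def)
      show "D n \<subseteq> {n..}" for n
      proof
        fix j assume "j \<in> D n"
        then obtain k where "k \<in> I n" "block_start b k \<le> j" by (auto simp: D_def block_def)
        then show "j \<in> {n..}"
          using interval_partition_ge[OF I, of k n] le_block_start[of b k, OF b] by simp
      qed
    qed
    moreover have "{x. decode b x \<sqsubset>\<^sup>\<bullet> (I, h)} \<subseteq> {x. \<forall>\<^sub>\<infinity>n. x \<notin> agreeing z (D n)}"
    proof
      fix x assume "x \<in> {x. decode b x \<sqsubset>\<^sup>\<bullet> (I, h)}"
      then obtain N where N: "\<And>n. n \<ge> N \<Longrightarrow> \<exists>k\<in>I n. decode b x k = h k"
        by (auto simp: eq_bounded_def MOST_nat_le)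
      obtain N' where N': "\<And>k. k \<ge> N' \<Longrightarrow> b k \<ge> 2" using b2 unfolding MOST_nat_le by blast
      have "x \<notin> agreeing z (D n)" if n: "n \<ge> max N N'" for n
      proof
        assume "x \<in> agreeing z (D n)"
        obtain k where k: "k \<in> I n" "decode b x k = h k" using N[of n] n by auto
        have "block b k \<subseteq> D n" using k(1) by (auto simp: D_def)
        then have "decode b x k = decode b z k"
          using \<open>x \<in> agreeing z (D n)\<close> agreeing_mono decode_cong by blast
        moreover have "b k \<ge> 2" using N'[of k] n interval_partition_ge[OF I k(1)] by simp
        ultimately show False using z k(2) by metis
      qed
      then show "x \<in> {x. \<forall>\<^sub>\<infinity>n. x \<notin> agreeing z (D n)}" unfolding MOST_nat_le by blast
    qed
    ultimately show ?thesis by (rule meager_subset)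
  qed
  then show ?thesis
    by (intro tukeyI[of _ "decode b" _ _ "\<lambda>y. {x. decode b x \<sqsubset>\<^sup>\<bullet> y}"])
      (auto simp: meager_ideal_def intro: decode_bounded[of b, OF b])
qed

text \<open>
  The meager set of \<open>f\<close> consists of the points whose function is eventually different from \<open>f\<close>. If
  the function coded by \<open>z\<close> misses \<open>f\<close> on infinitely many intervals of the partition of \<open>B\<close>, then a
  point that copies \<open>z\<close> there, and elsewhere codes values different from those of \<open>f\<close>, is in this set but
  not in \<open>B\<close>. The intervals of \<open>B\<close> have to consist of whole coding blocks for the gluing to respect
  decoding.
\<close>

lemma tukey_eq_meager:
  assumes b: "\<And>k. b k \<ge> 1" and b2: "\<forall>\<^sub>\<infinity>k. b k \<ge> 2"
  shows "tukey (bounded_functions b) (interval_partitions \<times> bounded_functions b) (\<sqsubset>\<^sup>\<bullet>)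
    meager_ideal meager_ideal (\<subseteq>)"
proof -
  define \<phi> where "\<phi> f = {x. \<forall>\<^sub>\<infinity>k. decode b x k \<noteq> f k}" for f
  let ?c = "block_start b"
  show ?thesis
  proof (rule tukeyI_ex[of _ \<phi>])
    fix f assume "f \<in> bounded_functions b"
    then obtain z where z: "decode b z = f" using decode_surj b by metis
    have "meager {x. \<forall>\<^sub>\<infinity>k. x \<notin> agreeing z (block b k)}"
    proof (rule meager_avoiding)
      show "finite (block b n)" "block b n \<subseteq> {n..}" for n
        using le_block_start[of b n, OF b] by (auto simp: block_def)
    qed
    moreover have "\<phi> f \<subseteq> {x. \<forall>\<^sub>\<infinity>k. x \<notin> agreeing z (block b k)}"
      unfolding \<phi>_def by (intro subsetI CollectI, elim CollectE eventually_mono)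
        (metis decode_cong z)
    ultimately show "\<phi> f \<in> meager_ideal"
      unfolding meager_ideal_def using meager_subset by blast
  next
    fix B assume "B \<in> meager_ideal"
    then have "meager B" by (simp add: meager_ideal_def)
    then obtain e z where e: "strict_mono e" "e 0 = 0"
      and B: "\<And>x. x \<in> B \<Longrightarrow> \<forall>\<^sub>\<infinity>i. x \<notin> agreeing z {?c (e i)..<?c (e (Suc i))}"
      using strict_mono_block_start[of b, OF b] by (rule meager_imp_blocks) blast
    define I where "I i = {e i..<e (Suc i)}" for i
    define d where "d i = ?c (e i)" for i
    have d: "strict_mono d"
      using e(1) strict_mono_block_start[of b, OF b] by (auto simp: d_def strict_mono_def)
    have "f \<sqsubset>\<^sup>\<bullet> (I, decode b z)" if sub: "\<phi> f \<subseteq> B" for f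
    proof (rule ccontr)
      assume not: "\<not> f \<sqsubset>\<^sup>\<bullet> (I, decode b z)"
      define T where "T = {i. \<not> (\<exists>k\<in>I i. f k = decode b z k)}"
      have T: "infinite T"
        unfolding T_def using not by (intro not_MOST_infinite) (simp add: eq_bounded_def)
      obtain z' where z': "\<And>k. b k \<ge> 2 \<Longrightarrow> decode b z' k \<noteq> f k" using decode_avoid b by metis
      define y where "y j = (if block_index d j \<in> T then z j else z' j)" for j
      have "decode b y k \<noteq> f k" if "b k \<ge> 2" for k
      proof -
        define i where "i = block_index e k"
        have i: "e i \<le> k" "k < e (Suc i)" using block_index_bounds[OF e(1)] by (simp_all add: i_def e(2))
        have "?c (e i) \<le> ?c k" "?c (Suc k) \<le> ?c (e (Suc i))"
          using i strict_mono_less_eq[OF strict_mono_block_start[of b, OF b]] by simp_all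
        then have idx: "block_index d j = i" if "j \<in> block b k" for j
          using that by (intro block_index_eq[OF d]) (auto simp: block_def d_def)
        show ?thesis
        proof (cases "i \<in> T")
          case True
          then have "y \<in> agreeing z (block b k)" by (intro agreeingI) (simp add: y_def idx)
          moreover have "f k \<noteq> decode b z k" using True i by (auto simp: T_def I_def)
          ultimately show ?thesis by (metis decode_cong)
        next
          case False
          then have "y \<in> agreeing z' (block b k)" by (intro agreeingI) (simp add: y_def idx)
          then show ?thesis using z'[OF that] by (metis decode_cong)
        qed
      qed
      then have "y \<in> \<phi> f" unfolding \<phi>_def using b2 by (auto elim: eventually_mono)
      then have avoid: "\<forall>\<^sub>\<infinity>i. y \<notin> agreeing z {?c (e i)..<?c (e (Suc i))}"
        using sub by (intro B) blast
      have "y \<in> agreeing z {?c (e i)..<?c (e (Suc i))}" if "i \<in> T" for i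
        by (rule agreeingI) (use block_index_eq[OF d, of i] that in \<open>simp add: y_def d_def\<close>)
      from T this avoid show False by (rule infinitely_often_contradiction)
    qed
    moreover have "(I, decode b z) \<in> interval_partitions \<times> bounded_functions b"
      using strict_mono_partition[OF e] decode_bounded[of b, OF b] unfolding I_def by simp
    ultimately show "\<exists>v\<in>interval_partitions \<times> bounded_functions b.
        \<forall>f\<in>bounded_functions b. \<phi> f \<subseteq> B \<longrightarrow> f \<sqsubset>\<^sup>\<bullet> v"
      by blast
  qed
qed

section \<open>The measure of the Cantor space\<close>

interpretation cantor: product_prob_space "\<lambda>_::nat. uniform_count_measure (UNIV :: bool set)" UNIV
  by (intro product_prob_spaceI prob_space_uniform_count_measure) simp_all

interpretation cantor_prob: prob_space cantor_measure
  unfolding cantor_measure_def by (rule cantor.P.prob_space_axioms)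

lemma space_cantor: "space cantor_measure = UNIV"
  by (simp add: cantor_measure_def space_PiM space_uniform_count_measure)

lemma measure_agreeing:
  assumes "finite D"
  shows "agreeing z D \<in> sets cantor_measure" "measure cantor_measure (agreeing z D) = (1 / 2) ^ card D"
proof -
  have eq: "agreeing z D = {x \<in> space cantor_measure. \<forall>i\<in>D. x i \<in> {z i}}"
    by (auto simp: agreeing_def space_cantor)
  show "agreeing z D \<in> sets cantor_measure"
    unfolding eq unfolding cantor_measure_def
    by (rule sets.sets_Collect_finite_All, rule sets_Collect_single')
      (simp_all add: assms sets_uniform_count_measure)
  have "emeasure (uniform_count_measure UNIV) {c} = ennreal (1 / 2)" for c :: bool
    by (subst emeasure_uniform_count_measure) simp_all
  then have "emeasure cantor_measure (agreeing z D) = ennreal ((1 / 2) ^ card D)"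
    unfolding eq unfolding cantor_measure_def
    by (subst cantor.emeasure_PiM_Collect)
      (simp_all add: assms sets_uniform_count_measure ennreal_power[symmetric])
  then show "measure cantor_measure (agreeing z D) = (1 / 2) ^ card D"
    by (simp add: measure_eq_emeasure_eq_ennreal)
qed

lemma measurable_pattern_set: "pattern_set p \<in> sets cantor_measure"
  by (cases p) (simp add: pattern_set_eq measure_agreeing)

lemma measurable_open: assumes "open U" shows "U \<in> sets cantor_measure"
proof -
  have "(\<Union>s\<in>{s. pattern_set (0, s) \<subseteq> U}. pattern_set (0, s)) \<in> sets cantor_measure"
    by (intro sets.countable_UN'' measurable_pattern_set) auto
  then show ?thesis using open_eq_UN_patterns[OF assms] by simp
qed

lemma measurable_closed: "closed F \<Longrightarrow> F \<in> sets cantor_measure"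
  using measurable_open[of "- F"] sets.compl_sets[of "- F" cantor_measure]
  by (simp add: closed_def space_cantor Compl_eq_Diff_UNIV[symmetric] double_complement)

lemma measurable_determined_by: "finite D \<Longrightarrow> determined_by D E \<Longrightarrow> E \<in> sets cantor_measure"
  by (rule measurable_open[OF open_determined_by])

lemma indep_coordinates:
  "cantor_prob.indep_vars (\<lambda>_. uniform_count_measure UNIV) (\<lambda>i x. x i) UNIV"
proof -
  have eq: "distr cantor_measure (uniform_count_measure UNIV) (\<lambda>x. x i) = uniform_count_measure UNIV" for i
    unfolding cantor_measure_def by (rule cantor.PiM_component) simp
  show ?thesis
    by (subst cantor_prob.indep_vars_iff_distr_eq_PiM)
      (simp_all add: eq, simp_all add: cantor_measure_def restrict_UNIV)
qed

text \<open>
  Each \<open>E k\<close> is the preimage of a set under restriction to \<open>L k\<close>, and restrictions to disjoint sets of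
  coordinates are independent.
\<close>

lemma measure_INT_determined:
  assumes "finite T" "disjoint_family_on L T"
    and "\<And>k. k \<in> T \<Longrightarrow> finite (L k)" "\<And>k. k \<in> T \<Longrightarrow> determined_by (L k) (E k)"
  shows "measure cantor_measure (\<Inter>k\<in>T. E k) = (\<Prod>k\<in>T. measure cantor_measure (E k))"
proof (cases "T = {}")
  case True
  then show ?thesis using cantor_prob.prob_space by (simp add: space_cantor)
next
  case False
  let ?U = "uniform_count_measure (UNIV :: bool set)"
  define r where "r k x = restrict x (L k)" for k and x :: "nat \<Rightarrow> bool"
  have "cantor_prob.indep_vars (\<lambda>k. Pi\<^sub>M (L k) (\<lambda>_. ?U)) (\<lambda>k x. restrict (\<lambda>i. x i) (L k)) T"
    by (rule cantor_prob.indep_vars_restrict[OF indep_coordinates _ assms(2)]) simp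
  then have ind: "cantor_prob.indep_vars (\<lambda>k. Pi\<^sub>M (L k) (\<lambda>_. ?U)) r T"
    by (simp add: r_def[abs_def])
  have vimage: "r k -` (r k ` E k) \<inter> space cantor_measure = E k" if "k \<in> T" for k
  proof -
    have "x \<in> E k" if "r k x = r k y" "y \<in> E k" for x y
    proof -
      have "x \<in> agreeing y (L k)"
      proof (rule agreeingI)
        fix i assume "i \<in> L k"
        then show "x i = y i" using fun_cong[OF that(1), of i] by (simp add: r_def)
      qed
      then show ?thesis using assms(4)[OF \<open>k \<in> T\<close>] that(2) unfolding determined_by_def by blast
    qed
    then show ?thesis by (auto simp: space_cantor)
  qed
  have meas: "r k ` E k \<in> sets (Pi\<^sub>M (L k) (\<lambda>_. ?U))" if "k \<in> T" for k
  proof -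
    have "r k ` E k \<subseteq> (\<Pi>\<^sub>E i\<in>L k. UNIV)" by (auto simp: r_def)
    then have fin: "finite (r k ` E k)"
      by (rule finite_subset) (simp add: finite_PiE assms(3) that)
    have "{r k x} \<in> sets (Pi\<^sub>M (L k) (\<lambda>_. ?U))" for x
    proof -
      have "{r k x} = (\<Pi>\<^sub>E i\<in>L k. {x i})"
        by (auto simp: r_def PiE_iff extensional_def restrict_def fun_eq_iff)
      then show ?thesis
        using sets_PiM_I_finite[OF assms(3)[OF that], of "\<lambda>i. {x i}" "\<lambda>_. ?U"]
        by (simp add: sets_uniform_count_measure)
    qed
    then have "(\<Union>f\<in>r k ` E k. {f}) \<in> sets (Pi\<^sub>M (L k) (\<lambda>_. ?U))"
      by (intro sets.finite_UN fin) auto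
    then show ?thesis by simp
  qed
  have "measure cantor_measure (\<Inter>k\<in>T. r k -` (r k ` E k) \<inter> space cantor_measure) =
      (\<Prod>k\<in>T. measure cantor_measure (r k -` (r k ` E k) \<inter> space cantor_measure))"
    by (rule cantor_prob.indep_varsD_finite[OF ind False assms(1) meas])
  then show ?thesis by (simp add: vimage cong: prod.cong INF_cong_simp)
qed

section \<open>Null sets\<close>

lemma null_idealI_measurable:
  assumes "N \<in> sets cantor_measure" "measure cantor_measure N = 0" "A \<subseteq> N"
  shows "A \<in> null_ideal"
  unfolding null_ideal_def null_sets_completion_iff2
  by (rule bexI[of _ N], rule assms(3)) (simp add: null_sets_def assms cantor_prob.emeasure_eq_measure)

lemma null_idealI:
  assumes "\<And>\<epsilon>. \<epsilon> > 0 \<Longrightarrow> \<exists>V\<in>sets cantor_measure. A \<subseteq> V \<and> measure cantor_measure V \<le> \<epsilon>"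
  shows "A \<in> null_ideal"
proof -
  have "\<exists>V\<in>sets cantor_measure. A \<subseteq> V \<and> measure cantor_measure V \<le> 1 / real (Suc n)" for n
    by (rule assms) simp
  then obtain V where V: "\<And>n. V n \<in> sets cantor_measure" "\<And>n. A \<subseteq> V n"
    "\<And>n. measure cantor_measure (V n) \<le> 1 / real (Suc n)" by metis
  have meas: "(\<Inter>n. V n) \<in> sets cantor_measure" using V(1) by auto
  have "measure cantor_measure (\<Inter>n. V n) \<le> 1 / real (Suc n)" for n
    using cantor_prob.finite_measure_mono[OF INT_lower[of n UNIV V] V(1)] V(3)[of n] by simp
  then have "measure cantor_measure (\<Inter>n. V n) \<le> 0"
    by (intro LIMSEQ_le_const[OF LIMSEQ_inverse_real_of_nat]) (simp add: inverse_eq_divide)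
  then have "measure cantor_measure (\<Inter>n. V n) = 0" by (simp add: measure_le_0_iff)
  with meas show ?thesis by (rule null_idealI_measurable) (use V(2) in blast)
qed

lemma null_ideal_subset: "A \<in> null_ideal \<Longrightarrow> B \<subseteq> A \<Longrightarrow> B \<in> null_ideal"
  unfolding null_ideal_def null_sets_completion_iff2 by blast

lemma null_ideal_countable_Union:
  assumes "countable \<J>" "\<J> \<subseteq> null_ideal"
  shows "\<Union>\<J> \<in> null_ideal"
  using null_sets_UN'[OF assms(1), of "\<lambda>A. A" "completion cantor_measure"] assms(2)
  unfolding null_ideal_def by auto

text \<open>
  Outer regularity is transferred from the Polish space of real sequences, into which the Cantor space
  embeds by \<open>g\<close>; the map \<open>h\<close> is a measurable left inverse, so that every measurable set is the preimage
  of a Borel set.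
\<close>

lemma null_ideal_open_cover:
  assumes "A \<in> null_ideal" "\<epsilon> > 0"
  obtains U where "open U" "A \<subseteq> U" "measure cantor_measure U < \<epsilon>"
proof -
  obtain N where N: "N \<in> null_sets cantor_measure" "A \<subseteq> N"
    using assms(1) unfolding null_ideal_def null_sets_completion_iff2 by blast
  define g :: "(nat \<Rightarrow> bool) \<Rightarrow> nat \<Rightarrow> real" where "g x i = of_bool (x i)" for x i
  define h :: "(nat \<Rightarrow> real) \<Rightarrow> nat \<Rightarrow> bool" where "h y i = (y i > 1 / 2)" for y i
  have hg: "h (g x) = x" for x by (simp add: h_def g_def fun_eq_iff of_bool_def)
  have g_cont: "open (g -` V)" if "open V" for V
  proof -
    have "continuous_on UNIV g"
      unfolding g_def
      by (intro continuous_on_coordinatewise_then_product)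
        (rule continuous_on_compose2[OF _ continuous_on_product_coordinates], auto)
    then show ?thesis using that by (simp add: continuous_on_open_vimage)
  qed
  have "g \<in> borel_measurable cantor_measure"
    by (rule borel_measurableI) (simp add: space_cantor measurable_open g_cont)
  have h_meas: "h \<in> measurable borel cantor_measure"
  proof -
    have "h \<in> measurable (Pi\<^sub>M UNIV (\<lambda>_::nat. borel :: real measure)) cantor_measure"
      unfolding cantor_measure_def h_def
      by (rule measurable_PiM_single') (auto simp: space_PiM space_uniform_count_measure)
    then show ?thesis
      using measurable_cong_sets[OF sets_PiM_equal_borel refl] by blast
  qed
  let ?M = "distr cantor_measure borel g"
  have "h -` N \<in> sets borel"
    using measurable_sets[OF h_meas, of N] N(1) by auto
  then have "emeasure ?M (h -` N) = (INF U\<in>{U. h -` N \<subseteq> U \<and> open U}. emeasure ?M U)"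
    by (intro outer_regular) (auto simp: emeasure_distr \<open>g \<in> _\<close> cantor_prob.emeasure_eq_measure)
  moreover have "emeasure ?M (h -` N) = 0"
    using \<open>h -` N \<in> sets borel\<close> \<open>g \<in> _\<close> N(1) by (simp add: emeasure_distr vimage_def hg space_cantor null_sets_def)
  ultimately have "(INF U\<in>{U. h -` N \<subseteq> U \<and> open U}. emeasure ?M U) < ennreal \<epsilon>"
    using assms(2) by simp
  then obtain U where U: "h -` N \<subseteq> U" "open U" "emeasure ?M U < ennreal \<epsilon>"
    unfolding INF_less_iff by blast
  have "emeasure cantor_measure (g -` U) < ennreal \<epsilon>"
    using U(2,3) \<open>g \<in> _\<close> by (simp add: emeasure_distr space_cantor)
  then have "measure cantor_measure (g -` U) < \<epsilon>"
    by (simp add: cantor_prob.emeasure_eq_measure ennreal_less_iff)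
  moreover have "A \<subseteq> g -` U"
  proof
    fix x assume "x \<in> A"
    then have "g x \<in> h -` N" using N(2) hg by auto
    then show "x \<in> g -` U" using U(1) by blast
  qed
  ultimately show ?thesis using that g_cont[OF U(2)] by blast
qed

text \<open>
  The Borel--Cantelli lemma.
\<close>

lemma null_ideal_limsup:
  assumes "\<And>n. E n \<in> sets cantor_measure" "summable (\<lambda>n. measure cantor_measure (E n))"
  shows "{x. \<not> (\<forall>\<^sub>\<infinity>n. x \<notin> E n)} \<in> null_ideal"
proof -
  have "limsup E \<in> null_sets cantor_measure"
    by (rule borel_cantelli_limsup1)
      (auto simp: assms cantor_prob.emeasure_eq_measure)
  moreover have "{x. \<not> (\<forall>\<^sub>\<infinity>n. x \<notin> E n)} \<subseteq> limsup E"
    by (auto simp: limsup_INF_SUP MOST_nat_le)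
  ultimately show ?thesis
    unfolding null_ideal_def null_sets_completion_iff2 by blast
qed

lemma proper_ideal_null: "proper_ideal null_ideal"
  unfolding proper_ideal_def
proof (intro conjI ballI allI impI)
  show "{x} \<in> null_ideal" for x
  proof (rule null_idealI)
    fix \<epsilon> :: real assume "\<epsilon> > 0"
    then obtain n where "(1 / 2) ^ n < \<epsilon>" using real_arch_pow_inv[of \<epsilon> "1 / 2"] by auto
    then show "\<exists>V\<in>sets cantor_measure. {x} \<subseteq> V \<and> measure cantor_measure V \<le> \<epsilon>"
      by (intro bexI[of _ "agreeing x {..<n}"]) (simp_all add: measure_agreeing)
  qed
  show "UNIV \<notin> null_ideal"
  proof
    assume "UNIV \<in> null_ideal"
    then obtain U where "UNIV \<subseteq> U" "measure cantor_measure U < 1"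
      by (rule null_ideal_open_cover[of UNIV 1]) simp_all
    then show False using cantor_prob.prob_space by (simp add: space_cantor top.extremum_unique)
  qed
qed (rule null_ideal_subset)

section \<open>Splitting the space into a meager and a null set\<close>

lemma null_window_limsup: "{x. \<not> (\<forall>\<^sub>\<infinity>n. x \<notin> agreeing y {n..<2 * n})} \<in> null_ideal"
  by (rule null_ideal_limsup) (simp_all add: measure_agreeing)

lemma meager_window: "meager {x. \<forall>\<^sub>\<infinity>n. x \<notin> agreeing y {n..<2 * n}}"
  by (rule meager_avoiding) auto

text \<open>
  Rothberger's inequalities. Agreement on infinitely many windows is a symmetric relation, so the
  same relation provides the null set of a point and the meager set of another one.
\<close>

lemma tukey_meager_null_dual: "tukey UNIV meager_ideal (\<in>) null_ideal UNIV (\<lambda>A x. x \<notin> A)"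
proof (rule tukeyI)
  show "{x. \<not> (\<forall>\<^sub>\<infinity>n. x \<notin> agreeing y {n..<2 * n})} \<in> null_ideal" for y
    by (rule null_window_limsup)
  show "{x. \<forall>\<^sub>\<infinity>n. x \<notin> agreeing y {n..<2 * n}} \<in> meager_ideal" for y
    using meager_window by (simp add: meager_ideal_def)
  show "x \<in> {x. \<forall>\<^sub>\<infinity>n. x \<notin> agreeing y {n..<2 * n}}"
    if "y \<notin> {y. \<not> (\<forall>\<^sub>\<infinity>n. y \<notin> agreeing x {n..<2 * n})}" for x y
    using that by (simp add: agreeing_sym[of y])
qed

section \<open>Divergent series and the measure of infinitely often equal sequences\<close>

text \<open>
  The event is the disjoint union of the patterns of length \<open>b k\<close> that code \<open>v\<close>, and there are at
  least \<open>2 ^ b k / (2 b k)\<close> of these.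
\<close>

lemma measure_decode_eq:
  assumes "v < b k"
  shows "measure cantor_measure {x. decode b x k = v} \<ge> 1 / (2 * real (b k))"
proof -
  let ?c = "block_start b"
  define W where "W = {l. length l = b k \<and> word_number (b k) l mod b k = v}"
  have fin: "finite W"
    using finite_lists_length_eq[of "UNIV :: bool set" "b k"] by (simp add: W_def)
  have "{x. decode b x k = v} = (\<Union>l\<in>W. pattern_set (?c k, l))"
  proof (intro set_eqI iffI)
    fix x assume "x \<in> {x. decode b x k = v}"
    then have "map x [?c k..<?c (Suc k)] \<in> W"
      by (simp add: W_def decode_def block_start_Suc)
    moreover have "x \<in> pattern_set (?c k, map x [?c k..<?c (Suc k)])"
      by (simp add: pattern_set_def)
    ultimately show "x \<in> (\<Union>l\<in>W. pattern_set (?c k, l))" by blast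
  next
    fix x assume "x \<in> (\<Union>l\<in>W. pattern_set (?c k, l))"
    then obtain l where l: "l \<in> W" "x \<in> pattern_set (?c k, l)" by blast
    then have "map x [?c k..<?c (Suc k)] = l"
      by (intro nth_equalityI) (simp_all add: W_def pattern_set_def block_start_Suc)
    then show "x \<in> {x. decode b x k = v}" using l(1) by (simp add: W_def decode_def)
  qed
  moreover have "measure cantor_measure (\<Union>l\<in>W. pattern_set (?c k, l)) =
      (\<Sum>l\<in>W. measure cantor_measure (pattern_set (?c k, l)))"
  proof (rule cantor_prob.finite_measure_finite_Union[OF fin])
    show "disjoint_family_on (\<lambda>l. pattern_set (?c k, l)) W"
      unfolding disjoint_family_on_def
    proof (intro ballI impI equals0I)
      fix l l' x assume "l \<in> W" "l' \<in> W" "l \<noteq> l'" "x \<in> pattern_set (?c k, l) \<inter> pattern_set (?c k, l')"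
      then have "l = l'"
        by (intro nth_equalityI) (auto simp: W_def pattern_set_def)
      with \<open>l \<noteq> l'\<close> show False by simp
    qed
  qed (use measurable_pattern_set in auto)
  moreover have "measure cantor_measure (pattern_set (?c k, l)) = (1 / 2) ^ b k" if "l \<in> W" for l
    using that by (simp add: pattern_set_eq measure_agreeing W_def)
  ultimately have eq: "measure cantor_measure {x. decode b x k = v} = real (card W) * (1 / 2) ^ b k"
    by simp
  have "2 ^ b k \<le> 2 * b k * card W"
    using card_word_residue[OF assms] by (simp add: W_def)
  then have "real (2 ^ b k) \<le> real (2 * b k * card W)"
    by (simp only: of_nat_le_iff)
  then have "(2 :: real) ^ b k \<le> 2 * real (b k) * real (card W)" by simp
  then show ?thesis
    using assms unfolding eq by (simp add: field_simps power_one_over)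
qed

lemma divergent_sum_partition:
  assumes "(\<Sum>k. ennreal (1 / real (b k))) = \<infinity>"
  obtains e where "strict_mono e" "e 0 = (0 :: nat)"
    "\<And>n. (\<Sum>k\<in>{e n..<e (Suc n)}. 1 / (2 * real (b k))) \<ge> real n"
proof -
  define a where "a k = 1 / (2 * real (b k))" for k
  have a0: "a k \<ge> 0" for k by (simp add: a_def)
  have "\<exists>m>s. (\<Sum>k\<in>{s..<m}. a k) \<ge> C" for s :: nat and C :: real
  proof (rule ccontr)
    assume not: "\<not> (\<exists>m>s. (\<Sum>k\<in>{s..<m}. a k) \<ge> C)"
    have bound: "(\<Sum>k<m. a k) \<le> (\<Sum>k<s. a k) + \<bar>C\<bar>" for m
    proof (cases "m \<le> s")
      case True
      then have "(\<Sum>k<m. a k) \<le> (\<Sum>k<s. a k)"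
        by (intro sum_mono2) (auto simp: a0)
      then show ?thesis by simp
    next
      case False
      then have "(\<Sum>k<m. a k) = (\<Sum>k<s. a k) + (\<Sum>k\<in>{s..<m}. a k)"
        using sum.atLeastLessThan_concat[of 0 s m a] by (simp add: lessThan_atLeast0)
      moreover have "(\<Sum>k\<in>{s..<m}. a k) < C" using not False by (meson not_le)
      ultimately show ?thesis by simp
    qed
    have "(\<Sum>k<m. ennreal (1 / real (b k))) \<le> ennreal (2 * ((\<Sum>k<s. a k) + \<bar>C\<bar>))" for m
    proof -
      have "(\<Sum>k<m. ennreal (1 / real (b k))) = ennreal (2 * (\<Sum>k<m. a k))"
        by (simp add: sum_ennreal sum_distrib_left a_def)
      also have "\<dots> \<le> ennreal (2 * ((\<Sum>k<s. a k) + \<bar>C\<bar>))"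
        using bound[of m] by (intro ennreal_leI) simp
      finally show ?thesis .
    qed
    then have "(\<Sum>k. ennreal (1 / real (b k))) \<le> ennreal (2 * ((\<Sum>k<s. a k) + \<bar>C\<bar>))"
      by (intro suminf_le_const) auto
    then show False using assms by (simp add: top_unique)
  qed
  then have "\<forall>n s. \<exists>m. m > s \<and> (\<Sum>k\<in>{s..<m}. a k) \<ge> real n" by blast
  then obtain m where "\<forall>n s. m n s > s \<and> (\<Sum>k\<in>{s..<m n s}. a k) \<ge> real n"
    unfolding choice_iff by blast
  then have m: "m n s > s" "(\<Sum>k\<in>{s..<m n s}. a k) \<ge> real n" for n s
    by blast+
  define e where "e = rec_nat 0 m"
  have e: "e 0 = 0" "e (Suc n) = m n (e n)" for n by (simp_all add: e_def)
  have "strict_mono e" by (simp add: strict_mono_Suc_iff e m(1))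
  moreover have "(\<Sum>k\<in>{e n..<e (Suc n)}. 1 / (2 * real (b k))) \<ge> real n" for n
    using m(2)[of n "e n"] by (simp add: e a_def)
  ultimately show ?thesis using that e(1) by blast
qed

lemma disjoint_blocks: assumes "\<And>k. b k \<ge> 1" shows "disjoint_family_on (block b) T"
  unfolding disjoint_family_on_def
proof (intro ballI impI equals0I)
  fix k k' j assume "k \<noteq> k'" "j \<in> block b k \<inter> block b k'"
  then show False
    using block_index_eq[OF strict_mono_block_start[of b, OF assms], of k j]
      block_index_eq[OF strict_mono_block_start[of b, OF assms], of k' j]
    by (simp add: block_def)
qed

text \<open>
  The partition is chosen so that the probabilities \<open>1 / (2 b k)\<close> of agreement in \<open>k\<close> add up to at least
  \<open>n\<close> over its \<open>n\<close>-th interval. Independence bounds the probability that \<open>f\<close> is missed on the whole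
  interval by \<open>exp (- n)\<close>, which is summable. One partition serves all \<open>f\<close>.
\<close>

lemma tukey_eq_null_dual:
  assumes b: "\<And>k. b k \<ge> 1" and div: "(\<Sum>k. ennreal (1 / real (b k))) = \<infinity>"
  shows "tukey (bounded_functions b) (interval_partitions \<times> bounded_functions b) (\<sqsubset>\<^sup>\<bullet>)
    null_ideal UNIV (\<lambda>A x. x \<notin> A)"
proof -
  obtain e where e: "strict_mono e" "e 0 = (0 :: nat)"
    "\<And>n. (\<Sum>k\<in>{e n..<e (Suc n)}. 1 / (2 * real (b k))) \<ge> real n"
    using divergent_sum_partition[OF div] by blast
  define I where "I n = {e n..<e (Suc n)}" for n
  have I: "I \<in> interval_partitions"
    unfolding I_def using strict_mono_partition[OF e(1,2)] .
  show ?thesis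
  proof (rule tukeyI)
    show "(I, decode b x) \<in> interval_partitions \<times> bounded_functions b" for x
      using I decode_bounded[of b, OF b] by simp
    show "f \<sqsubset>\<^sup>\<bullet> (I, decode b x)" if "x \<notin> {x. \<not> f \<sqsubset>\<^sup>\<bullet> (I, decode b x)}" for x f
      using that by simp
    show "{x. \<not> f \<sqsubset>\<^sup>\<bullet> (I, decode b x)} \<in> null_ideal" if f: "f \<in> bounded_functions b" for f
    proof -
      define E where "E n = (\<Inter>k\<in>I n. {x. decode b x k \<noteq> f k})" for n
      have det: "determined_by (block b k) {x. decode b x k \<noteq> f k}" for k
        unfolding determined_by_def using decode_cong by fastforce
      have fin: "finite (block b k)" for k by (simp add: block_def)
      have meas1: "{x. decode b x k \<noteq> f k} \<in> sets cantor_measure" for k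
        by (rule measurable_determined_by[OF fin det])
      have meas: "E n \<in> sets cantor_measure" for n
        unfolding E_def using meas1 e(1) by (intro sets.finite_INT) (auto simp: I_def strict_monoD)
      have "measure cantor_measure (E n) \<le> exp (- real n)" for n
      proof -
        have "measure cantor_measure (E n) = (\<Prod>k\<in>I n. measure cantor_measure {x. decode b x k \<noteq> f k})"
          unfolding E_def
          by (rule measure_INT_determined[where L = "block b"])
            (simp_all add: I_def disjoint_blocks[of b, OF b] det fin)
        also have "\<dots> \<le> (\<Prod>k\<in>I n. exp (- (1 / (2 * real (b k)))))"
        proof (intro prod_mono conjI measure_nonneg)
          fix k assume "k \<in> I n"
          have "f k < b k" using f by (auto simp: bounded_functions_def)
          have "{x. decode b x k \<noteq> f k} = space cantor_measure - {x. decode b x k = f k}"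
            by (auto simp: space_cantor)
          moreover have "{x. decode b x k = f k} \<in> sets cantor_measure"
            using sets.compl_sets[OF meas1[of k]] by (simp add: space_cantor set_diff_eq)
          ultimately have "measure cantor_measure {x. decode b x k \<noteq> f k} =
              1 - measure cantor_measure {x. decode b x k = f k}"
            by (simp add: cantor_prob.prob_compl)
          also have "\<dots> \<le> 1 - 1 / (2 * real (b k))"
            using measure_decode_eq[of "f k" b k, OF \<open>f k < b k\<close>] by simp
          also have "\<dots> \<le> exp (- (1 / (2 * real (b k))))"
            using exp_ge_add_one_self[of "- (1 / (2 * real (b k)))"] by simp
          finally show "measure cantor_measure {x. decode b x k \<noteq> f k} \<le> exp (- (1 / (2 * real (b k))))" .
        qed
        also have "\<dots> = exp (- (\<Sum>k\<in>I n. 1 / (2 * real (b k))))"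
          by (simp add: exp_sum I_def sum_negf[symmetric])
        also have "\<dots> \<le> exp (- real n)"
          using e(3)[of n] by (simp add: I_def)
        finally show ?thesis .
      qed
      then have le: "norm (measure cantor_measure (E n)) \<le> exp (- real n)" for n
        by simp
      have "summable (\<lambda>n. exp (- real n))"
      proof -
        have "summable (\<lambda>n. exp (- 1 :: real) ^ n)" by (rule summable_geometric) simp
        moreover have "exp (- 1 :: real) ^ n = exp (- real n)" for n
          using exp_of_nat_mult[of n "- 1 :: real"] by simp
        ultimately show ?thesis by simp
      qed
      then have "summable (\<lambda>n. measure cantor_measure (E n))"
        using le by (rule summable_comparison_test')
      with meas have "{x. \<not> (\<forall>\<^sub>\<infinity>n. x \<notin> E n)} \<in> null_ideal"
        by (rule null_ideal_limsup)
      moreover have "x \<in> E n \<longleftrightarrow> \<not> (\<exists>k\<in>I n. f k = decode b x k)" for x n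
        by (auto simp: E_def)
      ultimately show ?thesis by (simp add: eq_bounded_def)
    qed
  qed
qed

section \<open>The ideal generated by closed null sets\<close>

lemma E_idealI: "fsigma F \<Longrightarrow> F \<in> null_ideal \<Longrightarrow> A \<subseteq> F \<Longrightarrow> A \<in> E_ideal"
  unfolding E_ideal_def generated_ideal_def by (intro CollectI exI[of _ "{F}"]) auto

lemma E_ideal_subset_null: "E_ideal \<subseteq> null_ideal"
proof
  fix A assume "A \<in> E_ideal"
  then obtain \<F> where "finite \<F>" "\<F> \<subseteq> null_ideal" "A \<subseteq> \<Union>\<F>"
    unfolding E_ideal_def generated_ideal_def by blast
  then show "A \<in> null_ideal"
    by (blast intro: null_ideal_subset[OF null_ideal_countable_Union] countable_finite)
qed

text \<open>
  Nonempty open sets have positive measure.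
\<close>

lemma closed_null_nowhere_dense:
  assumes "closed F" "F \<in> null_ideal" shows "nowhere_dense F"
proof -
  have "x \<notin> interior F" for x
  proof
    assume "x \<in> interior F"
    then obtain n where "agreeing x {..<n} \<subseteq> interior F"
      using open_interior[of F] unfolding open_cantor_iff by blast
    then have n: "agreeing x {..<n} \<subseteq> F" using interior_subset by (rule subset_trans)
    have "agreeing x {..<n} \<in> null_ideal" using assms(2) n by (rule null_ideal_subset)
    then obtain U where "open U" "agreeing x {..<n} \<subseteq> U" "measure cantor_measure U < (1 / 2) ^ n"
      by (rule null_ideal_open_cover[of _ "(1 / 2) ^ n"]) simp_all
    then show False
      using cantor_prob.finite_measure_mono[of "agreeing x {..<n}" U] measurable_open[of U]
      by (simp add: measure_agreeing)
  qed
  then show ?thesis using assms(1) by (auto simp: nowhere_dense_def)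
qed

lemma E_ideal_subset_meager: "E_ideal \<subseteq> meager_ideal"
proof
  fix A assume "A \<in> E_ideal"
  then obtain \<F> where \<F>: "finite \<F>" "\<F> \<subseteq> {F \<in> null_ideal. fsigma F}" "A \<subseteq> \<Union>\<F>"
    unfolding E_ideal_def generated_ideal_def by blast
  have "meager F" if "F \<in> \<F>" for F
  proof -
    have F: "F \<in> null_ideal" "fsigma F" using \<F>(2) that by auto
    from F(2) obtain C where C: "\<And>n::nat. closed (C n)" "F = (\<Union>n. C n)"
      by (auto elim: fsigma.cases)
    have "C n \<in> null_ideal" for n
      using F(1) C(2) null_ideal_subset by blast
    then have "nowhere_dense (C n)" for n
      using C(1) closed_null_nowhere_dense by simp
    then show ?thesis
      unfolding meager_def using C(2) by (intro exI[of _ C]) simp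
  qed
  then have "meager (\<Union>\<F>)" using \<F>(1) by (intro meager_countable_Union countable_finite)
  then show "A \<in> meager_ideal" using \<F>(3) meager_subset by (auto simp: meager_ideal_def)
qed

lemma proper_ideal_E: "proper_ideal E_ideal"
  unfolding proper_ideal_def
proof (intro conjI ballI allI impI)
  show "B \<in> E_ideal" if A: "A \<in> E_ideal" and "B \<subseteq> A" for A B
  proof -
    obtain \<F> where "finite \<F>" "\<F> \<subseteq> {F \<in> null_ideal. fsigma F}" "A \<subseteq> \<Union>\<F>"
      using A unfolding E_ideal_def generated_ideal_def by blast
    then show ?thesis
      unfolding E_ideal_def generated_ideal_def
      by (intro CollectI exI[of _ \<F>] conjI subset_trans[OF \<open>B \<subseteq> A\<close>])
  qed
  show "UNIV \<notin> E_ideal"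
    using E_ideal_subset_null proper_idealD(3)[OF proper_ideal_null] by blast
  show "{x} \<in> E_ideal" for x
  proof (rule E_idealI)
    have "closed {x}"
    proof -
      have "- {x} = (\<Union>i. agreeing (\<lambda>i. \<not> x i) {i})"
        by (auto simp: agreeing_def fun_eq_iff)
      moreover have "open (\<Union>i. agreeing (\<lambda>i. \<not> x i) {i})"
        by (intro open_UN ballI open_agreeing) simp
      ultimately show ?thesis by (simp add: closed_def)
    qed
    then show "fsigma {x}" using fsigma.intros[of "\<lambda>_. {x}"] by simp
  qed (use proper_idealD(2)[OF proper_ideal_null] in auto)
qed

lemma ideal_subset_inequalities:
  assumes "proper_ideal \<I>" "proper_ideal \<J>" "\<I> \<subseteq> \<J>"
  shows "non_ideal \<I> \<le>o non_ideal \<J>" "cov_ideal \<J> \<le>o cov_ideal \<I>"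
proof -
  have t: "tukey UNIV \<J> (\<in>) UNIV \<I> (\<in>)"
    using assms(3) by (intro tukeyI[of _ "\<lambda>x. x" _ _ "\<lambda>A. A"]) auto
  have "\<exists>A\<in>\<I>. x \<in> A" for x using proper_idealD(2)[OF assms(1)] by blast
  then show "non_ideal \<I> \<le>o non_ideal \<J>" "cov_ideal \<J> \<le>o cov_ideal \<I>"
    using tukey_from_points[OF assms(2) t] by (simp_all add: non_ideal_eq[OF assms(1)] cov_ideal_eq[of \<I>])
qed

text \<open>
  The meager set of \<open>x\<close> consists of the points that agree with \<open>x\<close> on only finitely many windows
  \<open>[n, 2n)\<close>. The set for \<open>B\<close> consists of the points that agree with \<open>z\<close> on some window inside almost
  every interval of the partition of \<open>B\<close>: it is \<open>F\<^sub>\<sigma>\<close>, and null because a window \<open>[n, 2n)\<close>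
  has weight \<open>2 ^ - n\<close>. If \<open>x\<close> is not in this set, then one can copy \<open>z\<close> on sparsely many intervals without a
  window on which \<open>z\<close> agrees with \<open>x\<close>, and take the opposite of \<open>x\<close> elsewhere; the result belongs to
  the set of \<open>x\<close> but not to \<open>B\<close>.
\<close>

lemma tukey_point_E_meager: "tukey UNIV E_ideal (\<in>) meager_ideal meager_ideal (\<subseteq>)"
proof (rule tukeyI_ex)
  let ?\<phi> = "\<lambda>x. {y. \<forall>\<^sub>\<infinity>n. y \<notin> agreeing x {n..<2 * n}}"
  show "?\<phi> x \<in> meager_ideal" for x using meager_window by (simp add: meager_ideal_def)
  fix B assume "B \<in> meager_ideal"
  then have "meager B" by (simp add: meager_ideal_def)
  then obtain e z where e: "strict_mono e" "e 0 = 0"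
    and B: "\<And>x. x \<in> B \<Longrightarrow> \<forall>\<^sub>\<infinity>i. x \<notin> agreeing z {e i..<e (Suc i)}"
    by (rule meager_imp_intervals) blast
  define Idx where "Idx i = {n. e i \<le> n \<and> 2 * n \<le> e (Suc i)}" for i
  define G where "G i = (\<Union>n\<in>Idx i. agreeing z {n..<2 * n})" for i
  have det: "determined_by {..<e (Suc i)} (G i)" for i
    unfolding G_def
    by (rule determined_by_UN, rule determined_by_mono[OF determined_by_agreeing]) (auto simp: Idx_def)
  define W where "W = (\<Union>N. \<Inter>i\<in>{N..}. G i)"
  have closed: "closed (\<Inter>i\<in>{N..}. G i)" for N
    by (intro closed_INT ballI closed_determined_by[OF _ det]) simp
  have small: "measure cantor_measure (G i) \<le> 2 * (1 / 2) ^ i" for i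
  proof -
    have fin: "finite (Idx i)" by (rule finite_subset[of _ "{..e (Suc i)}"]) (auto simp: Idx_def)
    have ie: "i \<le> e i" by (rule strict_mono_imp_increasing[OF e(1)])
    have "measure cantor_measure (G i) \<le> (\<Sum>n\<in>Idx i. measure cantor_measure (agreeing z {n..<2 * n}))"
      unfolding G_def by (intro cantor_prob.finite_measure_subadditive_finite fin) (auto simp: measure_agreeing)
    also have "\<dots> = (\<Sum>n\<in>Idx i. (1 / 2) ^ n)" by (simp add: measure_agreeing)
    also have "\<dots> \<le> (\<Sum>n\<in>{i..<i + Suc (e (Suc i))}. (1 / 2) ^ n)"
      using ie by (intro sum_mono2) (auto simp: Idx_def)
    also have "\<dots> = (1 / 2) ^ i * (\<Sum>n<Suc (e (Suc i)). (1 / 2) ^ n)"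
      using sum.shift_bounds_nat_ivl[of "\<lambda>n. (1 / 2 :: real) ^ n" 0 i "Suc (e (Suc i))"]
      unfolding sum_distrib_left lessThan_atLeast0 power_add
      by (simp only: add_0 add.commute mult.commute)
    also have "\<dots> \<le> (1 / 2) ^ i * 2"
    proof (intro mult_left_mono)
      have "(\<Sum>n<k. (1 / 2 :: real) ^ n) = 2 - 2 * (1 / 2) ^ k" for k
        by (induction k) simp_all
      then show "(\<Sum>n<Suc (e (Suc i)). (1 / 2 :: real) ^ n) \<le> 2"
        by (simp del: sum.lessThan_Suc)
    qed simp
    finally show ?thesis by simp
  qed
  have null: "(\<Inter>i\<in>{N..}. G i) \<in> null_ideal" for N
  proof (rule null_idealI)
    fix \<epsilon> :: real assume "\<epsilon> > 0"
    then obtain n where "(1 / 2) ^ n < \<epsilon> / 2" using real_arch_pow_inv[of "\<epsilon> / 2" "1 / 2"] by auto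
    moreover have "(1 / 2 :: real) ^ (max N n) \<le> (1 / 2) ^ n" by (intro power_decreasing) auto
    ultimately have "measure cantor_measure (G (max N n)) \<le> \<epsilon>" using small[of "max N n"] by linarith
    moreover have "G (max N n) \<in> sets cantor_measure" by (rule measurable_determined_by[OF _ det]) simp
    moreover have "(\<Inter>i\<in>{N..}. G i) \<subseteq> G (max N n)" by auto
    ultimately show "\<exists>V\<in>sets cantor_measure. (\<Inter>i\<in>{N..}. G i) \<subseteq> V \<and> measure cantor_measure V \<le> \<epsilon>"
      by blast
  qed
  have "W \<in> null_ideal"
    unfolding W_def using null by (intro null_ideal_countable_Union) auto
  moreover have "fsigma W"
    unfolding W_def by (rule fsigma.intros) (rule closed)
  ultimately have "W \<in> E_ideal" by (intro E_idealI[of W]) auto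
  moreover have "x \<in> W" if sub: "?\<phi> x \<subseteq> B" for x
  proof (rule ccontr)
    assume "x \<notin> W"
    then have "\<not> (\<forall>\<^sub>\<infinity>i. x \<in> G i)" by (auto simp: W_def MOST_nat_le)
    then have "infinite {i. x \<notin> G i}" by (rule not_MOST_infinite)
    then obtain T where T: "T \<subseteq> {i. x \<notin> G i}" "infinite T" "\<And>i. i \<in> T \<Longrightarrow> Suc i \<notin> T"
      by (rule infinite_sparse_subset) blast
    define y where "y j = (if block_index e j \<in> T then z j else \<not> x j)" for j
    have "y \<notin> agreeing x {n..<2 * n}" if "n \<ge> 1" for n
    proof
      assume y: "y \<in> agreeing x {n..<2 * n}"
      have inT: "block_index e j \<in> T" if "j \<in> {n..<2 * n}" for j
        using agreeingD[OF y that] by (auto simp: y_def split: if_splits)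
      define i where "i = block_index e n"
      have i: "e i \<le> n" "n < e (Suc i)" using block_index_bounds[OF e(1)] by (simp_all add: i_def e(2))
      have iT: "i \<in> T" unfolding i_def by (rule inT) (use that in simp)
      \<comment> \<open>Otherwise the window would reach the interval after the \<open>i\<close>-th one, which is not copied.\<close>
      have "2 * n \<le> e (Suc i)"
      proof (rule ccontr)
        assume "\<not> 2 * n \<le> e (Suc i)"
        then have "block_index e (e (Suc i)) \<in> T" using i by (intro inT) simp
        moreover have "block_index e (e (Suc i)) = Suc i"
          by (rule block_index_eq[OF e(1)]) (use strict_monoD[OF e(1)] in auto)
        ultimately show False using T(3)[OF iT] by simp
      qed
      then have "n \<in> Idx i" using i by (simp add: Idx_def)
      moreover have "x \<in> agreeing z {n..<2 * n}"
      proof (rule agreeingI)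
        fix j assume j: "j \<in> {n..<2 * n}"
        then show "x j = z j" using inT[OF j] agreeingD[OF y j] by (simp add: y_def)
      qed
      ultimately have "x \<in> G i" by (auto simp: G_def)
      then show False using iT T(1) by blast
    qed
    then have "y \<in> ?\<phi> x" unfolding MOST_nat_le mem_Collect_eq by blast
    then have avoid: "\<forall>\<^sub>\<infinity>i. y \<notin> agreeing z {e i..<e (Suc i)}"
      using sub by (intro B) blast
    have "y \<in> agreeing z {e i..<e (Suc i)}" if "i \<in> T" for i
      by (rule agreeingI) (use block_index_eq[OF e(1), of i] that in \<open>simp add: y_def\<close>)
    from T(2) this avoid show False by (rule infinitely_often_contradiction)
  qed
  ultimately show "\<exists>v\<in>E_ideal. \<forall>x\<in>UNIV. ?\<phi> x \<subseteq> B \<longrightarrow> x \<in> v" by blast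
qed

section \<open>Slaloms capture meager sets\<close>

text \<open>
  The patterns of the list have pairwise disjoint ranges, in increasing order, starting at or after \<open>a\<close>.
\<close>

fun chained :: "nat \<Rightarrow> (nat \<times> bool list) list \<Rightarrow> bool"
  where "chained a [] \<longleftrightarrow> True"
  | "chained a (p # ps) \<longleftrightarrow> a \<le> fst p \<and> chained (fst p + length (snd p)) ps"

lemma chained_antimono: "chained a ps \<Longrightarrow> a' \<le> a \<Longrightarrow> chained a' ps"
  by (cases ps) auto

text \<open>
  One pattern from each list can be realised simultaneously. Among the first patterns of the lists
  the one that ends first is realised; in every other list the next pattern starts after this end, so
  the argument continues with the tails of the remaining lists.
\<close>

lemma greedy_patterns:
  assumes "finite C" "\<And>ps. ps \<in> C \<Longrightarrow> chained a ps \<and> card C \<le> length ps"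
  shows "\<exists>m z. \<forall>x\<in>agreeing z {a..<m}. \<forall>ps\<in>C. \<exists>p\<in>set ps. x \<in> pattern_set p"
  using assms
proof (induction "card C" arbitrary: C a rule: less_induct)
  case less
  show ?case
  proof (cases "C = {}")
    case False
    define fin where "fin ps = fst (hd ps) + length (snd (hd ps))" for ps :: "(nat \<times> bool list) list"
    obtain ps0 where ps0: "ps0 \<in> C" "\<And>ps. ps \<in> C \<Longrightarrow> fin ps0 \<le> fin ps"
      using ex_has_least_nat[of "\<lambda>ps. ps \<in> C" _ fin] False by blast
    have ne: "ps \<noteq> []" if "ps \<in> C" for ps
      using less.prems that False by (metis card_gt_0_iff le_zero_eq length_0_conv not_gr_zero)
    define C' where "C' = tl ` (C - {ps0})"
    have card': "card (C - {ps0}) < card C" "Suc (card (C - {ps0})) = card C"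
      using card_Suc_Diff1[OF less.prems(1) ps0(1)] by auto
    have C': "finite C'" "card C' \<le> card (C - {ps0})"
      using less.prems(1) by (auto simp: C'_def card_image_le)
    have "chained (fin ps0) qs \<and> card C' \<le> length qs" if "qs \<in> C'" for qs
    proof -
      obtain ps where ps: "ps \<in> C" "qs = tl ps" using \<open>qs \<in> C'\<close> by (auto simp: C'_def)
      obtain p where p: "ps = p # qs" using ne[OF ps(1)] ps(2) by (cases ps) auto
      have "chained (fin ps) qs" using less.prems(2)[OF ps(1)] by (simp add: p fin_def)
      moreover have "card C' \<le> length qs"
        using less.prems(2)[OF ps(1)] C'(2) card'(2) by (simp add: p)
      ultimately show ?thesis using ps0(2)[OF ps(1)] chained_antimono by blast
    qed
    moreover have "card C' < card C" using C'(2) card'(1) by simp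
    ultimately obtain m z where mz:
      "\<forall>x\<in>agreeing z {fin ps0..<m}. \<forall>ps\<in>C'. \<exists>p\<in>set ps. x \<in> pattern_set p"
      using less.hyps C'(1) by blast
    obtain s l ps' where s: "ps0 = (s, l) # ps'" using ne[OF ps0(1)] by (metis list.exhaust surj_pair)
    have fin0: "fin ps0 = s + length l" and as: "a \<le> s"
      using less.prems(2)[OF ps0(1)] by (simp_all add: s fin_def)
    define w where "w j = (if j < fin ps0 then l ! (j - s) else z j)" for j
    have "\<exists>p\<in>set ps. x \<in> pattern_set p"
      if x: "x \<in> agreeing w {a..<max (fin ps0) m}" and ps: "ps \<in> C" for x ps
    proof (cases "ps = ps0")
      case True
      have "x (s + i) = l ! i" if "i < length l" for i
        using agreeingD[OF x, of "s + i"] that as by (simp add: fin0 w_def)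
      then have "x \<in> pattern_set (s, l)" by (simp add: pattern_set_def)
      then show ?thesis by (simp add: True s)
    next
      case False
      have "x \<in> agreeing z {fin ps0..<m}"
      proof (rule agreeingI)
        fix j assume "j \<in> {fin ps0..<m}"
        then show "x j = z j" using agreeingD[OF x, of j] as by (simp add: w_def fin0)
      qed
      moreover have "tl ps \<in> C'" using False ps by (auto simp: C'_def)
      moreover have "set (tl ps) \<subseteq> set ps" by (cases ps) auto
      ultimately show ?thesis using mz by blast
    qed
    then show ?thesis by blast
  qed auto
qed

text \<open>
  The code of a meager set lists at \<open>n\<close> the \<open>H n\<close> consecutive blocks of its Talagrand description
  that start with the \<open>n\<close>-th one. A slalom with at most \<open>H n\<close> candidates at \<open>n\<close> leaves room
  to realise one block of each candidate beyond \<open>n\<close>. Points that match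
  the realised blocks for infinitely many \<open>n\<close> are outside every captured meager set, and the remaining
  points form a meager set.
\<close>

lemma slalom_captures_meager:
  fixes H :: "nat \<Rightarrow> nat"
  shows "\<exists>code :: (nat \<Rightarrow> bool) set \<Rightarrow> nat \<Rightarrow> nat.
    \<forall>S. (\<forall>n. finite (S n) \<and> card (S n) \<le> H n) \<longrightarrow>
      (\<exists>M. meager M \<and> (\<forall>A. meager A \<longrightarrow> (\<forall>\<^sub>\<infinity>n. code A n \<in> S n) \<longrightarrow> A \<subseteq> M))"
proof -
  define Q where "Q A e z \<longleftrightarrow> strict_mono e \<and> (\<forall>x\<in>A. \<forall>\<^sub>\<infinity>i. x \<notin> agreeing z {e i..<e (Suc i)})"
    for A and e :: "nat \<Rightarrow> nat" and z
  have "\<exists>e z. Q A e z" if "meager A" for A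
    using that by (rule meager_imp_intervals) (auto simp: Q_def)
  then obtain e z where Q: "\<And>A. meager A \<Longrightarrow> Q A (e A) (z A)" by metis
  define \<sigma> where "\<sigma> A i = (e A i, map (z A) [e A i..<e A (Suc i)])" for A i
  have \<sigma>: "pattern_set (\<sigma> A i) \<subseteq> agreeing (z A) {e A i..<e A (Suc i)}" for A i
  proof (intro subsetI agreeingI)
    fix x j assume "x \<in> pattern_set (\<sigma> A i)" and j: "j \<in> {e A i..<e A (Suc i)}"
    then have "\<forall>k<e A (Suc i) - e A i. x (e A i + k) = z A (e A i + k)"
      by (simp add: pattern_set_def \<sigma>_def)
    from this[rule_format, of "j - e A i"] show "x j = z A j" using j by auto
  qed
  have chain: "chained n (map (\<sigma> A) [i..<i + k])" if "strict_mono (e A)" "n \<le> e A i" for A n i k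
    using that
  proof (induction k arbitrary: n i)
    case (Suc k)
    have "e A i < e A (Suc i)" using Suc.prems strict_monoD by blast
    then have "fst (\<sigma> A i) + length (snd (\<sigma> A i)) = e A (Suc i)" by (simp add: \<sigma>_def)
    then show ?case
      using Suc.IH[of "e A (Suc i)" "Suc i"] Suc.prems
      by (simp add: upt_conv_Cons \<sigma>_def del: upt_Suc)
  qed auto
  define code where "code A n = to_nat (map (\<sigma> A) [n..<n + H n])" for A n
  have "\<exists>M. meager M \<and> (\<forall>A. meager A \<longrightarrow> (\<forall>\<^sub>\<infinity>n. code A n \<in> S n) \<longrightarrow> A \<subseteq> M)"
    if S: "\<forall>n. finite (S n) \<and> card (S n) \<le> H n" for S
  proof -
    define C where "C n = {ps. to_nat ps \<in> S n \<and> chained n ps \<and> length ps = H n}" for n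
    have C: "finite (C n) \<and> card (C n) \<le> H n" for n
    proof -
      have inj: "inj_on to_nat (C n)" by (rule inj_on_subset[OF inj_to_nat]) simp
      have sub: "to_nat ` C n \<subseteq> S n" by (auto simp: C_def)
      have "finite (to_nat ` C n)" using finite_subset[OF sub] S by blast
      moreover have "card (to_nat ` C n) \<le> H n" using card_mono[OF _ sub] S le_trans by blast
      ultimately show ?thesis using inj by (simp add: finite_image_iff card_image)
    qed
    have "\<exists>m z. \<forall>x\<in>agreeing z {n..<m}. \<forall>ps\<in>C n. \<exists>p\<in>set ps. x \<in> pattern_set p" for n
      using C[of n] by (intro greedy_patterns) (auto simp: C_def)
    then obtain m w where mw:
      "\<And>n. \<forall>x\<in>agreeing (w n) {n..<m n}. \<forall>ps\<in>C n. \<exists>p\<in>set ps. x \<in> pattern_set p"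
      by metis
    define M where "M = {x. \<forall>\<^sub>\<infinity>n. x \<notin> agreeing (w n) {n..<m n}}"
    have "meager M" unfolding M_def by (rule meager_avoiding) auto
    moreover have "A \<subseteq> M" if A: "meager A" "\<forall>\<^sub>\<infinity>n. code A n \<in> S n" for A
    proof
      fix x assume "x \<in> A"
      then have "\<forall>\<^sub>\<infinity>i. x \<notin> agreeing (z A) {e A i..<e A (Suc i)}"
        using Q[OF A(1)] by (auto simp: Q_def)
      then obtain N where N: "\<forall>i\<ge>N. x \<notin> agreeing (z A) {e A i..<e A (Suc i)}"
        unfolding MOST_nat_le by blast
      obtain N' where N': "\<forall>n\<ge>N'. code A n \<in> S n" using A(2) unfolding MOST_nat_le by blast
      have mono: "strict_mono (e A)" using Q[OF A(1)] by (simp add: Q_def)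
      have "x \<notin> agreeing (w n) {n..<m n}" if n: "n \<ge> max N N'" for n
      proof
        assume "x \<in> agreeing (w n) {n..<m n}"
        moreover have "map (\<sigma> A) [n..<n + H n] \<in> C n"
          using N' n chain[OF mono strict_mono_imp_increasing[OF mono]]
          by (simp add: C_def code_def)
        ultimately obtain p where "p \<in> set (map (\<sigma> A) [n..<n + H n])" "x \<in> pattern_set p"
          using mw by blast
        then obtain i where "i \<ge> n" "x \<in> pattern_set (\<sigma> A i)" by auto
        then show False using \<sigma> N n by fastforce
      qed
      then show "x \<in> M" unfolding M_def MOST_nat_le by blast
    qed
    ultimately show ?thesis by blast
  qed
  then show ?thesis by blast
qed

section \<open>Null sets capture slaloms\<close>

text \<open>
  The coordinates are arranged as an array of independent rows, via \<open>prod_encode\<close>; the event is that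
  row \<open>i\<close> starts with \<open>n\<close> zeros.
\<close>

definition zero_window :: "nat \<Rightarrow> nat \<Rightarrow> (nat \<Rightarrow> bool) set"
  where "zero_window n i = agreeing (\<lambda>_. False) ((\<lambda>j. prod_encode (i, j)) ` {..<n})"

definition row_null_set :: "(nat \<Rightarrow> nat) \<Rightarrow> (nat \<Rightarrow> bool) set"
  where "row_null_set f = {x. \<not> (\<forall>\<^sub>\<infinity>n. x \<notin> zero_window n (f n))}"

lemma measure_zero_window:
  "zero_window n i \<in> sets cantor_measure" "measure cantor_measure (zero_window n i) = (1 / 2) ^ n"
proof -
  have "inj_on (\<lambda>j. prod_encode (i, j)) {..<n}" by (auto simp: inj_on_def)
  then show "zero_window n i \<in> sets cantor_measure" "measure cantor_measure (zero_window n i) = (1 / 2) ^ n"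
    unfolding zero_window_def by (simp_all add: measure_agreeing card_image)
qed

lemma row_null_set_null: "row_null_set f \<in> null_ideal"
  unfolding row_null_set_def by (rule null_ideal_limsup) (simp_all add: measure_zero_window)

lemma measure_INT_not_zero_window:
  assumes "finite T"
  shows "measure cantor_measure (\<Inter>i\<in>T. - zero_window n i) = (1 - (1 / 2) ^ n) ^ card T"
proof -
  let ?L = "\<lambda>i. (\<lambda>j. prod_encode (i, j)) ` {..<n}"
  have "measure cantor_measure (\<Inter>i\<in>T. - zero_window n i) = (\<Prod>i\<in>T. measure cantor_measure (- zero_window n i))"
  proof (rule measure_INT_determined[OF assms, of ?L])
    show "disjoint_family_on ?L T" by (auto simp: disjoint_family_on_def)
    show "determined_by (?L i) (- zero_window n i)" for i
      unfolding zero_window_def by (intro determined_by_Compl determined_by_agreeing)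
  qed simp
  also have "\<dots> = (\<Prod>i\<in>T. 1 - (1 / 2) ^ n)"
    using cantor_prob.prob_compl[OF measure_zero_window(1)[of n]]
    by (simp add: space_cantor Compl_eq_Diff_UNIV measure_zero_window)
  finally show ?thesis by simp
qed

text \<open>
  Almost every point of \<open>E\<close> avoids all windows with index in \<open>T\<close>, which by independence has probability
  \<open>(1 - 2 ^ - n) ^ card T \<le> exp (- card T / 2 ^ n)\<close>.
\<close>

lemma card_missed_windows:
  assumes "E \<in> sets cantor_measure" "measure cantor_measure E \<ge> exp (- real n)"
    and "finite T" "\<And>i. i \<in> T \<Longrightarrow> measure cantor_measure (E \<inter> zero_window n i) = 0"
  shows "card T \<le> n * 2 ^ n"
proof -
  have meas: "E \<inter> zero_window n i \<in> sets cantor_measure" for i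
    using assms(1) measure_zero_window by auto
  have meas2: "(\<Inter>i\<in>T. - zero_window n i) \<in> sets cantor_measure"
    by (rule measurable_determined_by[of "\<Union>i\<in>T. (\<lambda>j. prod_encode (i, j)) ` {..<n}"])
      (auto simp: assms(3) zero_window_def determined_by_def agreeing_def)
  have "E \<subseteq> (\<Inter>i\<in>T. - zero_window n i) \<union> (\<Union>i\<in>T. E \<inter> zero_window n i)" by blast
  then have "measure cantor_measure E \<le>
      measure cantor_measure ((\<Inter>i\<in>T. - zero_window n i) \<union> (\<Union>i\<in>T. E \<inter> zero_window n i))"
    by (intro cantor_prob.finite_measure_mono sets.Un meas2 sets.finite_UN assms(3) meas)
  also have "\<dots> \<le> measure cantor_measure (\<Inter>i\<in>T. - zero_window n i) +
      measure cantor_measure (\<Union>i\<in>T. E \<inter> zero_window n i)"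
    by (intro measure_Un_le meas2 sets.finite_UN assms(3) meas)
  also have "measure cantor_measure (\<Union>i\<in>T. E \<inter> zero_window n i) \<le> 0"
    using cantor_prob.finite_measure_subadditive_finite[OF assms(3), of "\<lambda>i. E \<inter> zero_window n i"] meas
    by (simp add: assms(4) image_subset_iff)
  finally have "exp (- real n) \<le> (1 - (1 / 2) ^ n) ^ card T"
    using assms(2) by (simp add: measure_INT_not_zero_window[OF assms(3)])
  also have "\<dots> \<le> exp (- ((1 / 2) ^ n)) ^ card T"
  proof (intro power_mono)
    show "1 - (1 / 2) ^ n \<le> exp (- ((1 / 2 :: real) ^ n))"
      using exp_ge_add_one_self[of "- ((1 / 2 :: real) ^ n)"] by simp
    show "0 \<le> 1 - (1 / 2 :: real) ^ n" by (simp add: power_le_one)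
  qed
  also have "\<dots> = exp (- (real (card T) * (1 / 2) ^ n))"
    by (simp flip: exp_of_nat_mult)
  finally have "real (card T) * (1 / 2) ^ n \<le> real n" by simp
  then have "real (card T) \<le> real n * 2 ^ n"
    by (simp add: power_one_over field_simps)
  then have "real (card T) \<le> real (n * 2 ^ n)" by simp
  then show ?thesis by (simp only: of_nat_le_iff)
qed

text \<open>
  Finitely many cylinders of length \<open>m\<close> cover \<open>E\<close>, so one of them meets \<open>E\<close> in positive measure; its
  centre may be moved into \<open>E\<close>.
\<close>

lemma positive_refinement:
  assumes "E \<in> sets cantor_measure" "measure cantor_measure E > 0"
  obtains y where "y \<in> E" "measure cantor_measure (E \<inter> agreeing y {..<m}) > 0"
proof -
  define r where "r p i = (i \<in> p)" for p :: "nat set" and i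
  have "\<exists>p\<in>Pow {..<m}. measure cantor_measure (E \<inter> agreeing (r p) {..<m}) > 0"
  proof (rule ccontr)
    assume "\<not> ?thesis"
    then have zero: "measure cantor_measure (E \<inter> agreeing (r p) {..<m}) = 0" if "p \<in> Pow {..<m}" for p
      using that measure_nonneg[of cantor_measure "E \<inter> agreeing (r p) {..<m}"]
      by (meson antisym_conv1 not_le)
    have meas: "E \<inter> agreeing (r p) {..<m} \<in> sets cantor_measure" for p
      using assms(1) measure_agreeing by auto
    have "E \<subseteq> (\<Union>p\<in>Pow {..<m}. E \<inter> agreeing (r p) {..<m})"
    proof
      fix x assume "x \<in> E"
      then have "x \<in> E \<inter> agreeing (r {i. i < m \<and> x i}) {..<m}"
        by (simp add: agreeing_def r_def)
      then show "x \<in> (\<Union>p\<in>Pow {..<m}. E \<inter> agreeing (r p) {..<m})"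
        by (intro UN_I[of "{i. i < m \<and> x i}"]) auto
    qed
    then have "measure cantor_measure E \<le> measure cantor_measure (\<Union>p\<in>Pow {..<m}. E \<inter> agreeing (r p) {..<m})"
      by (intro cantor_prob.finite_measure_mono sets.finite_UN meas) simp_all
    also have "\<dots> \<le> (\<Sum>p\<in>Pow {..<m}. measure cantor_measure (E \<inter> agreeing (r p) {..<m}))"
      by (intro cantor_prob.finite_measure_subadditive_finite) (use meas in auto)
    also have "\<dots> = 0" using zero by simp
    finally show False using assms(2) by simp
  qed
  then obtain p where p: "measure cantor_measure (E \<inter> agreeing (r p) {..<m}) > 0" by blast
  then have "E \<inter> agreeing (r p) {..<m} \<noteq> {}" by auto
  then obtain y where y: "y \<in> E" "y \<in> agreeing (r p) {..<m}" by blast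
  have "agreeing (r p) {..<m} = agreeing y {..<m}"
    using y(2) by (simp add: agreeing_def)
  with p y(1) show ?thesis using that by simp
qed

text \<open>
  A Baire category argument inside \<open>K\<close>, with cylinders in which \<open>K\<close> has positive measure in place of
  nonempty relatively open sets. If the claim fails, then any such cylinder can be shrunk into a zero window
  \<open>(n, f n)\<close> with arbitrarily large \<open>n\<close>. The intersection of a shrinking sequence of cylinders is a
  point of \<open>K\<close>, since \<open>K\<close> is closed, that lies in infinitely many of these windows.
\<close>

lemma positive_cylinder_missing_windows:
  assumes K: "closed K" "measure cantor_measure K > 0" and "K \<inter> row_null_set f = {}"
  shows "\<exists>s N. measure cantor_measure (K \<inter> pattern_set (0, s)) > 0 \<and>
    (\<forall>n\<ge>N. measure cantor_measure (K \<inter> pattern_set (0, s) \<inter> zero_window n (f n)) = 0)"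
proof (rule ccontr)
  assume not: "\<not> ?thesis"
  have Kmeas: "K \<in> sets cantor_measure" using K(1) by (rule measurable_closed)
  have step: "\<exists>n\<ge>N. measure cantor_measure (K \<inter> agreeing y {..<m} \<inter> zero_window n (f n)) > 0"
    if pos: "measure cantor_measure (K \<inter> agreeing y {..<m}) > 0" for y m N
  proof -
    obtain n where "n \<ge> N" "measure cantor_measure (K \<inter> agreeing y {..<m} \<inter> zero_window n (f n)) \<noteq> 0"
      using not pos pattern_set_prefix[of y m] by metis
    then show ?thesis using measure_nonneg by (metis order.not_eq_order_implies_strict)
  qed
  define P where "P ym \<longleftrightarrow> measure cantor_measure (K \<inter> agreeing (fst ym) {..<snd ym}) > 0"
    for ym :: "(nat \<Rightarrow> bool) \<times> nat"
  define Q where "Q k ym ym' \<longleftrightarrow> snd ym < snd ym' \<and> fst ym' \<in> agreeing (fst ym) {..<snd ym} \<and>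
      (\<exists>n\<ge>k. agreeing (fst ym') {..<snd ym'} \<subseteq> zero_window n (f n))" for k and ym ym' :: "(nat \<Rightarrow> bool) \<times> nat"
  have "\<exists>g. \<forall>k. P (g k) \<and> Q k (g k) (g (Suc k))"
  proof (rule dependent_nat_choice)
    have "P (\<lambda>_. False, 0)" using K(2) by (simp add: P_def agreeing_def)
    then show "\<exists>ym. P ym" ..
  next
    fix ym k assume "P ym"
    obtain y m where ym: "ym = (y, m)" by (cases ym)
    obtain n where n: "n \<ge> k" "measure cantor_measure (K \<inter> agreeing y {..<m} \<inter> zero_window n (f n)) > 0"
      using step[of y m k] \<open>P ym\<close> unfolding P_def ym by auto
    obtain M where M: "(\<lambda>j. prod_encode (f n, j)) ` {..<n} \<subseteq> {..<M}"
      using finite_nat_iff_bounded by blast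
    define m' where "m' = max M (Suc m)"
    have E: "K \<inter> agreeing y {..<m} \<inter> zero_window n (f n) \<in> sets cantor_measure"
      using Kmeas measure_agreeing(1)[of "{..<m}" y] measure_zero_window(1) by auto
    obtain y' where y': "y' \<in> K \<inter> agreeing y {..<m} \<inter> zero_window n (f n)"
      "measure cantor_measure (K \<inter> agreeing y {..<m} \<inter> zero_window n (f n) \<inter> agreeing y' {..<m'}) > 0"
      by (rule positive_refinement[OF E n(2), of m']) blast
    have "measure cantor_measure (K \<inter> agreeing y {..<m} \<inter> zero_window n (f n) \<inter> agreeing y' {..<m'}) \<le>
        measure cantor_measure (K \<inter> agreeing y' {..<m'})"
      using Kmeas measure_agreeing(1)[of "{..<m'}" y']
      by (intro cantor_prob.finite_measure_mono) auto
    then have "P (y', m')" using y'(2) by (simp add: P_def)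
    moreover have "agreeing y' {..<m'} \<subseteq> zero_window n (f n)"
    proof
      fix x assume "x \<in> agreeing y' {..<m'}"
      moreover have "y' \<in> agreeing (\<lambda>_. False) ((\<lambda>j. prod_encode (f n, j)) ` {..<n})"
        using y'(1) by (simp add: zero_window_def)
      moreover have "(\<lambda>j. prod_encode (f n, j)) ` {..<n} \<subseteq> {..<m'}"
        using M by (rule subset_trans) (simp add: m'_def)
      ultimately show "x \<in> zero_window n (f n)"
        unfolding zero_window_def by (rule agreeing_trans)
    qed
    then have "Q k ym (y', m')"
      using y'(1) n(1) unfolding Q_def ym m'_def fst_conv snd_conv by (intro conjI) auto
    ultimately show "\<exists>ym'. P ym' \<and> Q k ym ym'" by blast
  qed
  then obtain g where g: "\<And>k. P (g k)" "\<And>k. Q k (g k) (g (Suc k))" by blast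
  define y m where "y k = fst (g k)" and "m k = snd (g k)" for k
  have mono: "strict_mono m" using g(2) by (simp add: strict_mono_Suc_iff Q_def m_def)
  have coh: "y (k + d) \<in> agreeing (y k) {..<m k}" for k d
  proof (induction d)
    case (Suc d)
    have "y (Suc (k + d)) \<in> agreeing (y (k + d)) {..<m (k + d)}"
      using g(2)[of "k + d"] by (simp add: Q_def y_def m_def)
    then show ?case
      using agreeing_trans[OF _ Suc.IH] mono by (simp add: strict_mono_less_eq)
  qed simp
  \<comment> \<open>Coordinate \<open>j\<close> is decided from stage \<open>j + 1\<close> on, as \<open>j < m (j + 1)\<close>.\<close>
  define x where "x j = y (Suc j) j" for j
  have x: "x \<in> agreeing (y k) {..<m k}" for k
  proof (rule agreeingI)
    fix j assume "j \<in> {..<m k}"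
    moreover have "j < m (Suc j)" using strict_mono_imp_increasing[OF mono, of "Suc j"] by simp
    ultimately have "y (max k (Suc j)) j = y k j" "y (max k (Suc j)) j = y (Suc j) j"
      using agreeingD[OF coh[of k "max k (Suc j) - k"], of j]
        agreeingD[OF coh[of "Suc j" "max k (Suc j) - Suc j"], of j] by simp_all
    then show "x j = y k j" by (simp add: x_def)
  qed
  have "x \<in> K"
  proof (rule ccontr)
    assume "x \<notin> K"
    then obtain n where n: "agreeing x {..<n} \<subseteq> - K"
      using K(1) unfolding closed_def open_cantor_iff by blast
    have "n \<le> m n" by (rule strict_mono_imp_increasing[OF mono])
    have "agreeing (y n) {..<m n} \<subseteq> agreeing x {..<n}"
      using agreeing_trans[OF _ x[of n, THEN agreeing_sym[THEN iffD1]], of _ "{..<m n}"]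
        agreeing_mono[of "{..<n}" "{..<m n}" x] \<open>n \<le> m n\<close> by auto
    then have "K \<inter> agreeing (y n) {..<m n} = {}" using n by blast
    then show False using g(1)[of n] by (simp add: P_def y_def m_def)
  qed
  moreover have "x \<in> row_null_set f"
  proof -
    have "\<exists>n\<ge>k. x \<in> zero_window n (f n)" for k
      using g(2)[of k] x[of "Suc k"] unfolding Q_def y_def m_def by blast
    then show ?thesis by (auto simp: row_null_set_def MOST_nat_le)
  qed
  ultimately show False using assms(3) by blast
qed

text \<open>
  If \<open>K\<close> is closed, of positive measure and disjoint from \<open>B\<close>, and the null set of \<open>f\<close> lies in \<open>B\<close>, then
  some cylinder \<open>s\<close> meets \<open>K\<close> in a set of positive measure that misses, up to measure zero, almost all
  windows \<open>(n, f n)\<close>. For a fixed \<open>s\<close> only few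
  indices at \<open>n\<close> can be missed (\<open>card_missed_windows\<close>), and \<open>S n\<close> collects those for the first \<open>n + 1\<close>
  cylinders. A cylinder whose part of \<open>K\<close> is small contributes only from a later \<open>n\<close> on, which is harmless
  as capturing is required for almost all \<open>n\<close>.
\<close>

lemma null_captures_slalom:
  assumes "B \<in> null_ideal"
  obtains S where "\<And>n. finite (S n) \<and> card (S n) \<le> Suc n * (n * 2 ^ n)"
    "\<And>f. row_null_set f \<subseteq> B \<Longrightarrow> \<forall>\<^sub>\<infinity>n. f n \<in> S n"
proof -
  obtain U where U: "open U" "B \<subseteq> U" "measure cantor_measure U < 1"
    by (rule null_ideal_open_cover[OF assms, of 1]) simp_all
  define K where "K = - U"
  have K: "closed K" using U(1) by (simp add: K_def closed_def)
  have "measure cantor_measure K = 1 - measure cantor_measure U"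
    using cantor_prob.prob_compl[OF measurable_open[OF U(1)]]
    by (simp add: K_def space_cantor Compl_eq_Diff_UNIV)
  then have Kpos: "measure cantor_measure K > 0" using U(3) by simp
  define E where "E k = K \<inter> pattern_set (0, from_nat k)" for k
  have E: "E k \<in> sets cantor_measure" for k
    unfolding E_def using measurable_closed[OF K] measurable_pattern_set by auto
  \<comment> \<open>The condition \<open>exp (- n) \<le> \<mu> (E k)\<close> holds for almost all \<open>n\<close> if \<open>E k\<close> has positive measure, and it
    is what makes the bound on the size uniform in \<open>k\<close>.\<close>
  define S1 where "S1 k n = (if measure cantor_measure (E k) \<ge> exp (- real n)
      then {i. measure cantor_measure (E k \<inter> zero_window n i) = 0} else {})" for k n
  have S1: "finite (S1 k n) \<and> card (S1 k n) \<le> n * 2 ^ n" for k n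
  proof (cases "measure cantor_measure (E k) \<ge> exp (- real n)")
    case True
    have *: "card T \<le> n * 2 ^ n" if "finite T" "T \<subseteq> S1 k n" for T
      using that True by (intro card_missed_windows[OF E True]) (auto simp: S1_def)
    have "finite (S1 k n)"
    proof (rule ccontr)
      assume "infinite (S1 k n)"
      then obtain T where "finite T" "card T = Suc (n * 2 ^ n)" "T \<subseteq> S1 k n"
        using infinite_arbitrarily_large by blast
      then show False using *[of T] by simp
    qed
    then show ?thesis using * by blast
  qed (simp add: S1_def)
  define S where "S n = (\<Union>k\<le>n. S1 k n)" for n
  have "finite (S n) \<and> card (S n) \<le> Suc n * (n * 2 ^ n)" for n
  proof
    show "finite (S n)" using S1 by (simp add: S_def)
    have "card (S n) \<le> (\<Sum>k\<le>n. card (S1 k n))" unfolding S_def by (rule card_UN_le) simp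
    also have "\<dots> \<le> (\<Sum>k\<le>n. n * 2 ^ n)" using S1 by (intro sum_mono) blast
    finally show "card (S n) \<le> Suc n * (n * 2 ^ n)" by simp
  qed
  moreover have "\<forall>\<^sub>\<infinity>n. f n \<in> S n" if "row_null_set f \<subseteq> B" for f
  proof -
    have "K \<inter> row_null_set f = {}" using that U(2) by (auto simp: K_def)
    then obtain s N where s: "measure cantor_measure (K \<inter> pattern_set (0, s)) > 0"
      "\<And>n. n \<ge> N \<Longrightarrow> measure cantor_measure (K \<inter> pattern_set (0, s) \<inter> zero_window n (f n)) = 0"
      using positive_cylinder_missing_windows[OF K Kpos] by blast
    define k where "k = to_nat s"
    have Ek: "E k = K \<inter> pattern_set (0, s)" by (simp add: E_def k_def)
    obtain N' :: nat where N': "- ln (measure cantor_measure (E k)) \<le> real N'"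
      using real_arch_simple by blast
    have "f n \<in> S n" if "n \<ge> max k (max N N')" for n
    proof -
      have "- real n \<le> ln (measure cantor_measure (E k))" using N' that by simp
      then have "exp (- real n) \<le> measure cantor_measure (E k)"
        using s(1) by (simp add: Ek ln_ge_iff)
      then have "f n \<in> S1 k n" using s(2)[of n] that by (simp add: S1_def Ek)
      then show ?thesis using that by (auto simp: S_def)
    qed
    then show ?thesis unfolding MOST_nat_le by blast
  qed
  ultimately show ?thesis by (rule that)
qed

text \<open>
  Composition of the two slalom lemmas; \<open>H\<close> is the bound that a null set yields.
\<close>

lemma tukey_meager_null: "tukey meager_ideal meager_ideal (\<subseteq>) null_ideal null_ideal (\<subseteq>)"
proof -
  define H where "H n = Suc n * (n * 2 ^ n)" for n
  obtain code :: "(nat \<Rightarrow> bool) set \<Rightarrow> nat \<Rightarrow> nat" where code: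
    "\<And>S. (\<forall>n. finite (S n) \<and> card (S n) \<le> H n) \<Longrightarrow>
      \<exists>M. meager M \<and> (\<forall>A. meager A \<longrightarrow> (\<forall>\<^sub>\<infinity>n. code A n \<in> S n) \<longrightarrow> A \<subseteq> M)"
    using slalom_captures_meager[of H] by blast
  show ?thesis
  proof (rule tukeyI_ex[of _ "\<lambda>A. row_null_set (code A)"])
    show "row_null_set (code A) \<in> null_ideal" for A by (rule row_null_set_null)
    fix B assume "B \<in> null_ideal"
    then obtain S where S: "\<And>n. finite (S n) \<and> card (S n) \<le> H n"
      "\<And>f. row_null_set f \<subseteq> B \<Longrightarrow> \<forall>\<^sub>\<infinity>n. f n \<in> S n"
      unfolding H_def by (rule null_captures_slalom) blast
    obtain M where "meager M" "\<And>A. meager A \<Longrightarrow> \<forall>\<^sub>\<infinity>n. code A n \<in> S n \<Longrightarrow> A \<subseteq> M"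
      using code[of S] S(1) by blast
    then show "\<exists>M\<in>meager_ideal. \<forall>A\<in>meager_ideal. row_null_set (code A) \<subseteq> B \<longrightarrow> A \<subseteq> M"
      using S(2) unfolding meager_ideal_def by blast
  qed
qed

section \<open>The extreme cardinals\<close>

lemma aleph_one_le_add_null: "aleph_one \<le>o add_ideal null_ideal"
proof -
  have ne: "{\<J>. \<J> \<subseteq> null_ideal \<and> \<Union>\<J> \<notin> null_ideal} \<noteq> {}"
  proof -
    have "range (\<lambda>x. {x}) \<in> {\<J>. \<J> \<subseteq> null_ideal \<and> \<Union>\<J> \<notin> null_ideal}"
      using proper_idealD(2,3)[OF proper_ideal_null] by auto
    then show ?thesis by blast
  qed
  obtain \<J> where J: "\<J> \<in> {\<J>. \<J> \<subseteq> null_ideal \<and> \<Union>\<J> \<notin> null_ideal}"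
    "min_card {\<J>. \<J> \<subseteq> null_ideal \<and> \<Union>\<J> \<notin> null_ideal} = |\<J>|"
    by (rule min_card_attained[OF ne]) blast
  have "\<not> countable \<J>" using J(1) null_ideal_countable_Union by blast
  have "\<not> |\<J>| \<le>o natLeq"
  proof
    assume "|\<J>| \<le>o natLeq"
    then have "|\<J>| \<le>o |UNIV :: nat set|"
      by (rule ordLeq_ordIso_trans[OF _ ordIso_symmetric[OF card_of_nat]])
    then obtain f :: "(nat \<Rightarrow> bool) set \<Rightarrow> nat" where "inj_on f \<J>"
      unfolding card_of_ordLeq[symmetric] by blast
    then show False using \<open>\<not> countable \<J>\<close> countableI by blast
  qed
  then have "natLeq <o |\<J>|"
    by (simp add: not_ordLeq_iff_ordLess card_of_Well_order natLeq_Well_order)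
  then have "cardSuc natLeq \<le>o |\<J>|"
    by (rule cardSuc_least[OF natLeq_Card_order card_of_Card_order])
  then show ?thesis using J(2) by (simp add: aleph_one_def add_ideal_def)
qed

text \<open>
  Every null set is contained in a null set of the form \<open>\<Inter>n. U n\<close> with \<open>U n\<close> open, and a sequence of open
  sets is coded by the set of pairs \<open>(n, s)\<close> such that the cylinder of \<open>s\<close> is contained in \<open>U n\<close>.
\<close>

lemma cof_null_le_continuum: "cof_ideal null_ideal \<le>o continuum"
proof -
  define G :: "(nat \<Rightarrow> bool) \<Rightarrow> (nat \<Rightarrow> bool) set" where
    "G u = (\<Inter>n. \<Union>s\<in>{s. u (to_nat (n :: nat, s :: bool list))}. pattern_set (0, s))" for u
  let ?J = "range G \<inter> null_ideal"
  have "\<exists>B\<in>?J. A \<subseteq> B" if "A \<in> null_ideal" for A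
  proof -
    have "\<exists>U. open U \<and> A \<subseteq> U \<and> measure cantor_measure U < 1 / real (Suc n)" for n
      by (rule null_ideal_open_cover[OF that, of "1 / real (Suc n)"]) auto
    then obtain U where U: "\<And>n. open (U n)" "\<And>n. A \<subseteq> U n"
      "\<And>n. measure cantor_measure (U n) < 1 / real (Suc n)" by metis
    define u where "u k = (case from_nat k of (n, s) \<Rightarrow> pattern_set (0, s) \<subseteq> U n)" for k
    have "(\<Union>s\<in>{s. u (to_nat (n, s))}. pattern_set (0, s)) = U n" for n
      using open_eq_UN_patterns[OF U(1)[of n]] by (simp add: u_def)
    then have G: "G u = (\<Inter>n. U n)" by (simp add: G_def)
    have "G u \<in> null_ideal"
    proof (rule null_idealI)
      fix \<epsilon> :: real assume "\<epsilon> > 0"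
      then obtain n where "1 / real (Suc n) < \<epsilon>"
        using reals_Archimedean by (auto simp: inverse_eq_divide)
      then have "measure cantor_measure (U n) \<le> \<epsilon>" using U(3)[of n] by linarith
      then show "\<exists>V\<in>sets cantor_measure. G u \<subseteq> V \<and> measure cantor_measure V \<le> \<epsilon>"
        using measurable_open[OF U(1)[of n]] unfolding G by blast
    qed
    moreover have "A \<subseteq> G u" using U(2) G by blast
    ultimately show ?thesis by blast
  qed
  then have "cof_ideal null_ideal \<le>o |?J|"
    unfolding cof_ideal_def by (intro min_card_le) blast
  also have "|?J| \<le>o |range G|" by (rule card_of_mono1) blast
  also have "|range G| \<le>o |UNIV :: (nat \<Rightarrow> bool) set|" by (rule card_of_image)
  also have "|UNIV :: (nat \<Rightarrow> bool) set| =o continuum"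
  proof -
    have "Func (Field natLeq) (Field (ctwo :: bool rel)) = UNIV"
      by (auto simp: Func_def ctwo_def Field_natLeq Field_card_of)
    then have "continuum = |UNIV :: (nat \<Rightarrow> bool) set|" by (simp add: cexp_def)
    then show ?thesis by (simp add: card_of_refl)
  qed
  finally show ?thesis .
qed

lemma le_star_refl: "f \<le>\<^sup>* f"
  by (simp add: le_star_def)

lemma le_star_unbounded: "\<exists>f. \<not> f \<le>\<^sup>* g"
proof
  show "\<not> (\<lambda>n. Suc (g n)) \<le>\<^sup>* g" by (simp add: le_star_def)
qed

lemma bounding_le_dominating: "bounding_number \<le>o dominating_number"
  unfolding bounding_number_eq dominating_number_eq dominating_card_eq_dual
proof (rule tukey_bounding_card)
  show "tukey UNIV UNIV (\<lambda>g f. \<not> f \<le>\<^sup>* g) UNIV UNIV (\<le>\<^sup>*)"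
  proof (rule tukeyI[of _ "\<lambda>g. g" _ _ "\<lambda>g n. Suc (g n)"])
    fix f g :: "nat \<Rightarrow> nat" assume le: "f \<le>\<^sup>* g"
    show "\<not> (\<lambda>n. Suc (g n)) \<le>\<^sup>* f"
    proof
      assume "(\<lambda>n. Suc (g n)) \<le>\<^sup>* f"
      with le have "\<forall>\<^sub>\<infinity>n. f n \<le> g n \<and> Suc (g n) \<le> f n"
        unfolding le_star_def by (simp add: eventually_conj)
      then show False by (auto simp: MOST_nat_le)
    qed
  qed auto
  show "\<exists>g\<in>UNIV. \<not> \<not> f \<le>\<^sup>* g" for f :: "nat \<Rightarrow> nat" using le_star_refl by blast
qed

lemma eq_bounded_by_itself: "\<exists>v\<in>interval_partitions \<times> bounded_functions b. f \<sqsubset>\<^sup>\<bullet> v"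
  if "f \<in> bounded_functions b"
proof -
  have "(\<lambda>i. {i..<Suc i}) \<in> interval_partitions"
    using strict_mono_partition[of "\<lambda>i. i"] by (simp add: strict_mono_def)
  then show ?thesis
    using that by (intro bexI[of _ "(\<lambda>i. {i..<Suc i}, f)"]) (auto simp: eq_bounded_def)
qed

lemma eq_unbounded:
  assumes "\<And>k. b k \<ge> 1" "\<forall>\<^sub>\<infinity>k. b k \<ge> 2" "v \<in> interval_partitions \<times> bounded_functions b"
  shows "\<exists>f\<in>bounded_functions b. \<not> f \<sqsubset>\<^sup>\<bullet> v"
proof -
  obtain I h where v: "v = (I, h)" "I \<in> interval_partitions" using assms(3) by blast
  obtain z where z: "\<And>k. b k \<ge> 2 \<Longrightarrow> decode b z k \<noteq> h k" using decode_avoid assms(1) by metis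
  obtain N where N: "\<And>k. k \<ge> N \<Longrightarrow> b k \<ge> 2" using assms(2) unfolding MOST_nat_le by blast
  have "\<not> (\<exists>k\<in>I n. decode b z k = h k)" if "n \<ge> N" for n
    using interval_partition_ge[OF v(2), of _ n] z N that by (meson le_trans)
  then have "\<not> decode b z \<sqsubset>\<^sup>\<bullet> v"
    unfolding v eq_bounded_def MOST_nat_le fst_conv snd_conv by (meson nat_le_linear)
  then show ?thesis using decode_bounded[of b, OF assms(1)] by blast
qed

section \<open>The diagram\<close>

theorem theoremB:
  fixes b :: "nat \<Rightarrow> nat"
  assumes "\<forall>k. b k \<ge> 1" and "\<forall>\<^sub>\<infinity>k. b k \<ge> 2"
  shows
   "(add_ideal meager_ideal \<le>o b_eq b \<and> b_eq b \<le>o non_ideal meager_ideal \<and>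
     cov_ideal meager_ideal \<le>o d_eq b \<and> d_eq b \<le>o cof_ideal meager_ideal)
    \<and>
    ((\<Sum>k. ennreal (1 / real (b k))) = \<infinity> \<longrightarrow>
       cov_ideal null_ideal \<le>o b_eq b \<and> d_eq b \<le>o non_ideal null_ideal)
    \<and>
    (aleph_one \<le>o add_ideal null_ideal \<and>
     add_ideal null_ideal \<le>o cov_ideal null_ideal \<and>
     cov_ideal null_ideal \<le>o non_ideal meager_ideal \<and>
     non_ideal meager_ideal \<le>o cof_ideal meager_ideal \<and>
     cof_ideal meager_ideal \<le>o cof_ideal null_ideal \<and>
     cof_ideal null_ideal \<le>o continuum \<and>
     add_ideal null_ideal \<le>o add_ideal meager_ideal \<and>
     add_ideal meager_ideal \<le>o cov_ideal meager_ideal \<and>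
     cov_ideal meager_ideal \<le>o non_ideal null_ideal \<and>
     non_ideal null_ideal \<le>o cof_ideal null_ideal \<and>
     add_ideal meager_ideal \<le>o bounding_number \<and>
     bounding_number \<le>o non_ideal meager_ideal \<and>
     cov_ideal meager_ideal \<le>o dominating_number \<and>
     dominating_number \<le>o cof_ideal meager_ideal \<and>
     bounding_number \<le>o dominating_number \<and>
     add_ideal meager_ideal \<le>o non_ideal E_ideal \<and>
     non_ideal E_ideal \<le>o non_ideal meager_ideal \<and>
     non_ideal E_ideal \<le>o non_ideal null_ideal \<and>
     non_ideal E_ideal \<le>o cof_ideal meager_ideal \<and>
     add_ideal meager_ideal \<le>o cov_ideal E_ideal \<and>
     cov_ideal meager_ideal \<le>o cov_ideal E_ideal \<and>
     cov_ideal null_ideal \<le>o cov_ideal E_ideal \<and>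
     cov_ideal E_ideal \<le>o cof_ideal meager_ideal)"
proof -
  have b: "\<And>k. b k \<ge> 1" using assms(1) by blast
  note M = ideal_trivial_inequalities[OF proper_ideal_meager]
  note N = ideal_trivial_inequalities[OF proper_ideal_null]
  have N_dual: "\<exists>x\<in>UNIV. x \<notin> A" if "A \<in> null_ideal" for A
    using proper_idealD(4)[OF proper_ideal_null that] by blast
  have eq: "add_ideal meager_ideal \<le>o b_eq b" "d_eq b \<le>o cof_ideal meager_ideal"
    unfolding b_eq_eq d_eq_eq
    using tukey_from_ideal[OF proper_ideal_meager tukey_eq_meager[of b, OF b assms(2)]
        eq_unbounded[of b, OF b assms(2)]] by blast+
  have eq': "b_eq b \<le>o non_ideal meager_ideal" "cov_ideal meager_ideal \<le>o d_eq b"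
    unfolding b_eq_eq d_eq_eq
    using tukey_from_points[OF proper_ideal_meager tukey_point_meager_eq[of b, OF b assms(2)]
        eq_bounded_by_itself] by blast+
  have div: "cov_ideal null_ideal \<le>o b_eq b \<and> d_eq b \<le>o non_ideal null_ideal"
    if "(\<Sum>k. ennreal (1 / real (b k))) = \<infinity>"
    unfolding b_eq_eq d_eq_eq bounding_card_dual_points[symmetric]
      dominating_card_dual_points[OF proper_ideal_null, symmetric]
    using tukey_bounding_card[OF tukey_eq_null_dual[of b, OF b that] eq_unbounded[of b, OF b assms(2)]]
      tukey_dominating_card[OF tukey_eq_null_dual[of b, OF b that] N_dual] by blast
  have rothberger: "cov_ideal null_ideal \<le>o non_ideal meager_ideal"
    "cov_ideal meager_ideal \<le>o non_ideal null_ideal"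
    using tukey_from_points[OF proper_ideal_meager tukey_meager_null_dual N_dual]
    by (simp_all add: bounding_card_dual_points dominating_card_dual_points[OF proper_ideal_null])
  have bartoszynski: "add_ideal null_ideal \<le>o add_ideal meager_ideal"
    "cof_ideal meager_ideal \<le>o cof_ideal null_ideal"
  proof -
    have "\<exists>A\<in>meager_ideal. \<not> A \<subseteq> B" if "B \<in> meager_ideal" for B
      using proper_idealD(2,4)[OF proper_ideal_meager] that by blast
    then show "add_ideal null_ideal \<le>o add_ideal meager_ideal"
      unfolding add_ideal_eq[OF proper_ideal_meager] add_ideal_eq[OF proper_ideal_null]
      by (rule tukey_bounding_card[OF tukey_meager_null])
    show "cof_ideal meager_ideal \<le>o cof_ideal null_ideal"
      unfolding cof_ideal_eq by (rule tukey_dominating_card[OF tukey_meager_null]) blast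
  qed
  have bd: "add_ideal meager_ideal \<le>o bounding_number" "dominating_number \<le>o cof_ideal meager_ideal"
    unfolding bounding_number_eq dominating_number_eq
    using tukey_from_ideal[OF proper_ideal_meager tukey_le_star_meager] le_star_unbounded by blast+
  have bd': "bounding_number \<le>o non_ideal meager_ideal" "cov_ideal meager_ideal \<le>o dominating_number"
    unfolding bounding_number_eq dominating_number_eq
    using tukey_from_points[OF proper_ideal_meager tukey_point_meager_le_star] le_star_refl by blast+
  have E: "add_ideal meager_ideal \<le>o non_ideal E_ideal" "cov_ideal E_ideal \<le>o cof_ideal meager_ideal"
    unfolding non_ideal_eq[OF proper_ideal_E] cov_ideal_eq[of E_ideal]
    using tukey_from_ideal[OF proper_ideal_meager tukey_point_E_meager]
      proper_idealD(4)[OF proper_ideal_E] by blast+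
  note EM = ideal_subset_inequalities[OF proper_ideal_E proper_ideal_meager E_ideal_subset_meager]
  note EN = ideal_subset_inequalities[OF proper_ideal_E proper_ideal_null E_ideal_subset_null]
  show ?thesis
    using eq eq' div M N rothberger bartoszynski bd bd' E EM EN
      aleph_one_le_add_null cof_null_le_continuum bounding_le_dominating
      ordLeq_transitive[OF EM(1) M(4)] ordLeq_transitive[OF M(3) EM(2)]
    by blast
qed

end
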